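(* Let $R,P>0$, $S=\{(x,y)\in\mathbb{R}^2:|y|\le R\}$, $a\in\mathbb{R}$, $k\ge0$, $\alpha\in(0,1)$, and suppose $\phi_i^\pm\in C^{k+2,\alpha}(\mathbb{R})$ for $i=1,2$ satisfy $\phi_i^\pm(x+P)=\phi_i^\pm(x)$, $\phi_1^\pm(x)<\phi_2^\pm(x)$ for all $x\in\mathbb{R}$, and $\int_0^P\phi^+_i\,dx=\int_0^P\phi_i^-\,dx$. Let $(u_i,v_i)$ be the (singular) solution associated to $\phi_i^\pm$ as below, for $i=1,2$. Then $v_1<v_2$ on $S$.
   Context: For $a\in\mathbb{R}$ let $(\dagger_a)$ denote $\frac{\partial u}{\partial x}=\frac{\partial v}{\partial y}$, $\frac{\partial v}{\partial x}=-2(v^2+y^2+a^2)^{1/2}\frac{\partial u}{\partial y}$. Given $P$-periodic $\phi^\pm\in C^{k+2,\alpha}(\mathbb{R})$ with equal integrals over $[0,P]$, the associated solution $(u,v)$ is the unique pair which is $P$-periodic in $x$, has $u(0,0)=0$, $v(x,\pm R)=\phi^\pm(x)$, and is a $C^{k+2,\alpha}$ solution of $(\dagger_a)$ if $a\ne0$, resp. a singular solution of $(\dagger_0)$ if $a=0$ (existence and uniqueness hold). A singular solution of $(\dagger_0)$: $u,v\in C^0(S)$ weakly differentiable with weak derivatives satisfying $(\dagger_0)$; $v$ a weak solution of $\partial_x[(v^2+y^2)^{-1/2}\partial_xv]+2\partial_y^2v=0$; $u,v$ are $C^2$, real-analytic in the interior and classical solutions away from points $(x,0)$ with $v(x,0)=0$;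 and $u,v$ are $C^0$ limits as $b\to0_+$ of $C^2$ solutions of $(\dagger_b)$. *)

theory Defs
  imports "HOL-Analysis.Analysis"
begin

definition strip :: "real \<Rightarrow> (real \<times> real) set" where
  "strip R = {p. \<bar>snd p\<bar> \<le> R}"

definition strip_int :: "real \<Rightarrow> (real \<times> real) set" where
  "strip_int R = {p. \<bar>snd p\<bar> < R}"

definition ex :: "real \<times> real" where "ex = (1, 0)"
definition ey :: "real \<times> real" where "ey = (0, 1)"

definition dderiv :: "'a::real_normed_vector set \<Rightarrow> 'a \<Rightarrow> ('a \<Rightarrow> real) \<Rightarrow> 'a \<Rightarrow> real" where
  "dderiv S v f = (\<lambda>p. frechet_derivative f (at p within S) v)"

fun ideriv :: "'a::real_normed_vector set \<Rightarrow> 'a list \<Rightarrow> ('a \<Rightarrow> real) \<Rightarrow> 'a \<Rightarrow> real" where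
  "ideriv S [] f = f"
| "ideriv S (v # vs) f = dderiv S v (ideriv S vs f)"

(* C^k on S, B = set of coordinate directions *)
fun Ck :: "nat \<Rightarrow> 'a::real_normed_vector set \<Rightarrow> 'a set \<Rightarrow> ('a \<Rightarrow> real) \<Rightarrow> bool" where
  "Ck 0 S B f = continuous_on S f"
| "Ck (Suc k) S B f = (continuous_on S f \<and> (\<forall>p\<in>S. f differentiable (at p within S))
      \<and> (\<forall>v\<in>B. Ck k S B (dderiv S v f)))"

definition hoelder :: "nat \<Rightarrow> real \<Rightarrow> 'a::real_normed_vector set \<Rightarrow> 'a set \<Rightarrow> ('a \<Rightarrow> real) \<Rightarrow> bool" where
  "hoelder k \<alpha> S B f \<longleftrightarrow> Ck k S B f \<and>
     (\<forall>ds. set ds \<subseteq> B \<and> length ds \<le> k \<longrightarrow>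
        bounded (ideriv S ds f ` S) \<and>
        (\<exists>C. \<forall>p\<in>S. \<forall>q\<in>S. \<bar>ideriv S ds f p - ideriv S ds f q\<bar> \<le> C * dist p q powr \<alpha>))"

definition solves :: "real \<Rightarrow> real \<Rightarrow> (real \<times> real \<Rightarrow> real) \<Rightarrow> (real \<times> real \<Rightarrow> real) \<Rightarrow> (real \<times> real) set \<Rightarrow> bool" where
  "solves a R u v T \<longleftrightarrow> (\<forall>p\<in>T.
      dderiv T ex u p = dderiv T ey v p \<and>
      dderiv T ex v p = - 2 * sqrt ((v p)\<^sup>2 + (snd p)\<^sup>2 + a\<^sup>2) * dderiv T ey u p)"

definition test_fun :: "(real \<times> real) set \<Rightarrow> (real \<times> real \<Rightarrow> real) \<Rightarrow> bool" where
  "test_fun U \<phi> \<longleftrightarrow> (\<forall>k. Ck k UNIV {ex, ey} \<phi>) \<and>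
     compact (closure {p. \<phi> p \<noteq> 0}) \<and> closure {p. \<phi> p \<noteq> 0} \<subseteq> U"

definition weak_deriv :: "(real \<times> real) set \<Rightarrow> real \<times> real \<Rightarrow> (real \<times> real \<Rightarrow> real) \<Rightarrow> (real \<times> real \<Rightarrow> real) \<Rightarrow> bool" where
  "weak_deriv U v f g \<longleftrightarrow>
     (\<forall>K. compact K \<and> K \<subseteq> U \<longrightarrow> set_integrable lborel K f \<and> set_integrable lborel K g) \<and>
     (\<forall>\<phi>. test_fun U \<phi> \<longrightarrow>
        (LINT p|lborel. f p * dderiv UNIV v \<phi> p) = - (LINT p|lborel. g p * \<phi> p))"

definition real_analytic_on :: "(real \<times> real \<Rightarrow> real) \<Rightarrow> (real \<times> real) set \<Rightarrow> bool" where
  "real_analytic_on f U \<longleftrightarrow> (\<forall>p\<in>U. \<exists>r>0. \<exists>c :: nat \<Rightarrow> nat \<Rightarrow> real. \<forall>q\<in>ball p r.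
      ((\<lambda>(i,j). c i j * (fst q - fst p) ^ i * (snd q - snd p) ^ j) has_sum f q) UNIV)"

definition sing_sol :: "real \<Rightarrow> (real \<times> real \<Rightarrow> real) \<Rightarrow> (real \<times> real \<Rightarrow> real) \<Rightarrow> bool" where
  "sing_sol R u v \<longleftrightarrow>
    (let S = strip R; U = strip_int R; Z = {p. snd p = 0 \<and> v p = 0} in
     continuous_on S u \<and> continuous_on S v \<and>
     (\<exists>ux uy vx vy.
        weak_deriv U ex u ux \<and> weak_deriv U ey u uy \<and>
        weak_deriv U ex v vx \<and> weak_deriv U ey v vy \<and>
        (AE p in lborel. p \<in> U \<longrightarrow>
            ux p = vy p \<and> vx p = - 2 * sqrt ((v p)\<^sup>2 + (snd p)\<^sup>2) * uy p) \<and>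
        (\<forall>\<phi>. test_fun U \<phi> \<longrightarrow>
            integrable lborel (\<lambda>p. vx p / sqrt ((v p)\<^sup>2 + (snd p)\<^sup>2) * dderiv UNIV ex \<phi> p
                                  + 2 * vy p * dderiv UNIV ey \<phi> p) \<and>
            (LINT p|lborel. vx p / sqrt ((v p)\<^sup>2 + (snd p)\<^sup>2) * dderiv UNIV ex \<phi> p
                                  + 2 * vy p * dderiv UNIV ey \<phi> p) = 0)) \<and>
     Ck 2 (S - Z) {ex, ey} u \<and> Ck 2 (S - Z) {ex, ey} v \<and>
     real_analytic_on u (U - Z) \<and> real_analytic_on v (U - Z) \<and>
     solves 0 R u v (S - Z) \<and>
     (\<exists>ub vb :: real \<Rightarrow> real \<times> real \<Rightarrow> real.
        uniform_limit S ub u (at_right 0) \<and> uniform_limit S vb v (at_right 0) \<and>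
        (\<forall>\<^sub>F b in at_right 0. Ck 2 S {ex, ey} (ub b) \<and> Ck 2 S {ex, ey} (vb b) \<and>
                               solves b R (ub b) (vb b) S)))"

definition assoc_sol :: "nat \<Rightarrow> real \<Rightarrow> real \<Rightarrow> real \<Rightarrow> real \<Rightarrow> (real \<Rightarrow> real) \<Rightarrow> (real \<Rightarrow> real)
    \<Rightarrow> (real \<times> real \<Rightarrow> real) \<Rightarrow> (real \<times> real \<Rightarrow> real) \<Rightarrow> bool" where
  "assoc_sol k \<alpha> a R P phip phim u v \<longleftrightarrow>
     (\<forall>x y. \<bar>y\<bar> \<le> R \<longrightarrow> u (x + P, y) = u (x, y) \<and> v (x + P, y) = v (x, y)) \<and>
     u (0, 0) = 0 \<and>
     (\<forall>x. v (x, R) = phip x \<and> v (x, - R) = phim x) \<and>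
     (if a \<noteq> 0
      then hoelder (k + 2) \<alpha> (strip R) {ex, ey} u \<and> hoelder (k + 2) \<alpha> (strip R) {ex, ey} v
           \<and> solves a R u v (strip R)
      else sing_sol R u v)"

end

theory Submission
  imports Defs
begin

text \<open>For \<open>b \<noteq> 0\<close> put \<open>F(v) = arsinh (v / sqrt (y\<^sup>2 + b\<^sup>2))\<close>. A solution of the system satisfies
  \<open>F(v)\<^sub>x\<^sub>x + 2 v\<^sub>y\<^sub>y = 0\<close>, and since \<open>F\<close> is increasing and odd, supersolutions of this equation are stable under
  infima of \<open>x\<close>-translates and subsolutions are their negatives. Integrating against weights in \<open>x\<close> reduces
  everything to the one-dimensional maximum principle in \<open>y\<close>. This gives the weak comparison principle. For strictness,
  let \<open>V\<close> be the infimum of the translates of \<open>v\<^sub>2\<close> and \<open>-N\<close> the supremum of those of \<open>v\<^sub>1\<close> by at most \<open>s\<close>.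
  The strict gap on the boundary gives \<open>V + N \<ge> 0\<close>, and the integral \<open>E(y)\<close> of \<open>V + N\<close> against a cosine bump of
  radius \<open>s\<close> at \<open>x\<^sub>0\<close> is bounded below by a positive constant which does not depend on \<open>b\<close>. As
  \<open>V + N \<le> v\<^sub>2(x\<^sub>0, y) - v\<^sub>1(x\<^sub>0, y)\<close> on the support of the bump, the strict inequality survives
  the limit \<open>b \<rightarrow> 0\<close>.\<close>

text \<open>The obstacle is the coefficient (v^2 + y^2 + b^2)^(-1/2), which blows up at v = y = 0 as
  b tends to 0, so a strong maximum principle applied for each b gives no gap uniform in b.
  Integration in x avoids differentiating F: the second difference in x moves to the weight, and
  F(V) - F(-N) enters undifferentiated, with the sign of V + N. Translates are needed because a
  positive average of v2 - v1 over the bump would give strictness only at some point of its support.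
  They cost smoothness, V and N being merely continuous, and this forces second differences in place
  of derivatives. Two bounds free of b carry the lower estimate of E. The first, F(v) - F(w) <= (v -
  w) / y for w <= v and y > 0, leads to E(y) >= c |y| but is void at y = 0. The second, F(v) <= 2
  sqrt(M / |y|) for v <= M, loses the factor V + N, but its singularity has order below 1, so across
  |y| <= h it costs only O(h^(3/2)), less than the gain c h at y = h and y = -h.\<close>

section \<open>Second differences, the maximum principle in one variable, mixed partials\<close>

definition sdiff :: "(real \<Rightarrow> real) \<Rightarrow> real \<Rightarrow> real \<Rightarrow> real" where
  "sdiff f k x = f (x + k) + f (x - k) - 2 * f x"

text \<open>Two mean value steps, first for \<open>f s - f (s - k)\<close> and then for
  \<open>f'\<close>. The identity is exact at one intermediate point, so later only the oscillation
  of the second derivative enters the error.\<close>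

lemma sdiff_mvt:
  fixes f f' f'' :: "real \<Rightarrow> real"
  assumes k: "0 < k"
    and f: "\<And>s. \<bar>s - y\<bar> \<le> k \<Longrightarrow> (f has_real_derivative f' s) (at s)"
    and f': "\<And>s. \<bar>s - y\<bar> \<le> k \<Longrightarrow> (f' has_real_derivative f'' s) (at s)"
  shows "\<exists>\<xi>. \<bar>\<xi> - y\<bar> < k \<and> sdiff f k y = k\<^sup>2 * f'' \<xi>"
proof -
  define g where "g s = f s - f (s - k)" for s
  have "(g has_real_derivative f' s - f' (s - k)) (at s)" if "y \<le> s" "s \<le> y + k" for s
    unfolding g_def
    by (rule DERIV_diff f DERIV_shift[THEN iffD1])+
       (use that k f[of "s - k"] in \<open>auto simp: DERIV_shift[of f _ s "-k", simplified]\<close>)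
  from MVT2[of y "y + k" g, OF _ this] k
  obtain s where s: "y < s" "s < y + k" "g (y + k) - g y = k * (f' s - f' (s - k))"
    by auto
  have "\<exists>\<xi>. s - k < \<xi> \<and> \<xi> < s \<and> f' s - f' (s - k) = (s - (s - k)) * f'' \<xi>"
    by (rule MVT2) (use s k f' in auto)
  then obtain \<xi> where \<xi>: "s - k < \<xi>" "\<xi> < s" "f' s - f' (s - k) = k * f'' \<xi>"
    by auto
  have "sdiff f k y = g (y + k) - g y" by (simp add: sdiff_def g_def)
  then have "sdiff f k y = k\<^sup>2 * f'' \<xi>"
    using s(3) \<xi>(3) by (simp add: power2_eq_square)
  moreover have "\<bar>\<xi> - y\<bar> < k" using s \<xi> by auto
  ultimately show ?thesis by blast
qed

text \<open>At a negative interior minimum every second difference that stays in the interval is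
  nonnegative. One scale \<open>k\<close>, depending on the point, already gives the contradiction,
  so barriers are checked only at one small \<open>k\<close> and only where \<open>f\<close> is
  negative.\<close>

lemma sdiff_nonneg_imp_nonneg:
  fixes f :: "real \<Rightarrow> real"
  assumes cont: "continuous_on {lo..hi} f" and ends: "0 \<le> f lo" "0 \<le> f hi"
    and neg: "\<And>y. \<lbrakk>lo < y; y < hi; f y < 0\<rbrakk> \<Longrightarrow>
      \<exists>k>0. lo \<le> y - k \<and> y + k \<le> hi \<and> sdiff f k y < 0"
    and y: "y \<in> {lo..hi}"
  shows "0 \<le> f y"
proof (rule ccontr)
  assume "\<not> 0 \<le> f y"
  obtain z where z: "z \<in> {lo..hi}" "\<And>t. t \<in> {lo..hi} \<Longrightarrow> f z \<le> f t"
    using continuous_attains_inf[OF compact_Icc _ cont] y by auto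
  have "f z < 0" using z(2)[OF y] \<open>\<not> 0 \<le> f y\<close> by simp
  moreover have "z \<noteq> lo" "z \<noteq> hi" using \<open>f z < 0\<close> ends by auto
  ultimately obtain k where k: "k > 0" "lo \<le> z - k" "z + k \<le> hi" "sdiff f k z < 0"
    using neg[of z] z(1) by auto
  have "f z \<le> f (z - k)" "f z \<le> f (z + k)" using z k by auto
  then show False using k(4) by (simp add: sdiff_def)
qed

text \<open>The double increment over a square of side \<open>h\<close>, evaluated by mean values in
  either order, is h^2 times each mixed derivative at some point of the square. Applied to u, it
  turns u_x = v_y into information on the x-derivative of u_y.\<close>

lemma mixed_partials_commute:
  fixes f fx fy fxy fyx :: "real \<times> real \<Rightarrow> real"
  assumes r: "0 < r"
    and fx: "\<And>x y. \<lbrakk>\<bar>x - x0\<bar> \<le> r; \<bar>y - y0\<bar> \<le> r\<rbrakk> \<Longrightarrow> ((\<lambda>x. f (x, y)) has_real_derivative fx (x, y)) (at x)"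
    and fy: "\<And>x y. \<lbrakk>\<bar>x - x0\<bar> \<le> r; \<bar>y - y0\<bar> \<le> r\<rbrakk> \<Longrightarrow> ((\<lambda>y. f (x, y)) has_real_derivative fy (x, y)) (at y)"
    and fxy: "\<And>x y. \<lbrakk>\<bar>x - x0\<bar> \<le> r; \<bar>y - y0\<bar> \<le> r\<rbrakk> \<Longrightarrow> ((\<lambda>y. fx (x, y)) has_real_derivative fxy (x, y)) (at y)"
    and fyx: "\<And>x y. \<lbrakk>\<bar>x - x0\<bar> \<le> r; \<bar>y - y0\<bar> \<le> r\<rbrakk> \<Longrightarrow> ((\<lambda>x. fy (x, y)) has_real_derivative fyx (x, y)) (at x)"
    and c: "isCont fxy (x0, y0)" "isCont fyx (x0, y0)"
  shows "fxy (x0, y0) = fyx (x0, y0)"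
proof (rule ccontr)
  assume ne: "fxy (x0, y0) \<noteq> fyx (x0, y0)"
  define e where "e = \<bar>fxy (x0, y0) - fyx (x0, y0)\<bar> / 2"
  have e: "e > 0" using ne by (simp add: e_def)
  obtain d1 where d1: "d1 > 0" "\<And>p. dist p (x0, y0) < d1 \<Longrightarrow> dist (fxy p) (fxy (x0, y0)) < e"
    using c(1) e unfolding continuous_at_eps_delta by (metis dist_commute)
  obtain d2 where d2: "d2 > 0" "\<And>p. dist p (x0, y0) < d2 \<Longrightarrow> dist (fyx p) (fyx (x0, y0)) < e"
    using c(2) e unfolding continuous_at_eps_delta by (metis dist_commute)
  \<comment> \<open>The open square lies within distance 2 h of its corner, hence the halving of
    \<open>d1\<close> and \<open>d2\<close>.\<close>
  define h where "h = min r (min d1 d2 / 2)"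
  have h: "0 < h" "h \<le> r" "2 * h \<le> d1" "2 * h \<le> d2" using r d1 d2 by (auto simp: h_def)
  define D where "D = f (x0 + h, y0 + h) - f (x0 + h, y0) - f (x0, y0 + h) + f (x0, y0)"
  have near: "dist (s, t) (x0, y0) < 2 * h" if "x0 < s" "s < x0 + h" "y0 < t" "t < y0 + h" for s t
  proof -
    have "dist (s, t) (x0, y0) \<le> \<bar>s - x0\<bar> + \<bar>t - y0\<bar>"
      using norm_Pair_le[of "s - x0" "t - y0"] by (simp add: dist_norm)
    then show ?thesis using that by auto
  qed
  have "\<exists>s. x0 < s \<and> s < x0 + h \<and> (f (x0 + h, y0 + h) - f (x0 + h, y0)) - (f (x0, y0 + h) - f (x0, y0))
      = (x0 + h - x0) * (fx (s, y0 + h) - fx (s, y0))"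
    by (rule MVT2) (use h in \<open>auto intro!: DERIV_diff fx\<close>)
  then obtain s where s: "x0 < s" "s < x0 + h" "D = h * (fx (s, y0 + h) - fx (s, y0))"
    by (auto simp: D_def algebra_simps)
  have "\<exists>t. y0 < t \<and> t < y0 + h \<and> fx (s, y0 + h) - fx (s, y0) = (y0 + h - y0) * fxy (s, t)"
    by (rule MVT2) (use h s in \<open>auto intro!: fxy\<close>)
  then obtain t where t: "y0 < t" "t < y0 + h" "D = h * (h * fxy (s, t))"
    using s(3) by auto
  have "\<exists>t. y0 < t \<and> t < y0 + h \<and> (f (x0 + h, y0 + h) - f (x0, y0 + h)) - (f (x0 + h, y0) - f (x0, y0))
      = (y0 + h - y0) * (fy (x0 + h, t) - fy (x0, t))"
    by (rule MVT2) (use h in \<open>auto intro!: DERIV_diff fy\<close>)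
  then obtain t' where t': "y0 < t'" "t' < y0 + h" "D = h * (fy (x0 + h, t') - fy (x0, t'))"
    by (auto simp: D_def algebra_simps)
  have "\<exists>s. x0 < s \<and> s < x0 + h \<and> fy (x0 + h, t') - fy (x0, t') = (x0 + h - x0) * fyx (s, t')"
    by (rule MVT2) (use h t' in \<open>auto intro!: fyx\<close>)
  then obtain s' where s': "x0 < s'" "s' < x0 + h" "D = h * (h * fyx (s', t'))"
    using t'(3) by auto
  have "fxy (s, t) = fyx (s', t')" using t(3) s'(3) h(1) by simp
  moreover have "dist (fxy (s, t)) (fxy (x0, y0)) < e"
    using d1(2) near[of s t] s t h by force
  moreover have "dist (fyx (s', t')) (fyx (x0, y0)) < e"
    using d2(2) near[of s' t'] s' t' h by force
  ultimately have "dist (fxy (x0, y0)) (fyx (x0, y0)) < e + e"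
    using dist_triangle_less_add[of "fxy (x0, y0)" "fyx (s', t')" e "fyx (x0, y0)" e]
    by (simp add: dist_commute)
  then show False by (simp add: e_def dist_real_def)
qed

section \<open>The potential of the equation and its bounds\<close>

text \<open>The primitive in v of (v^2 + y^2 + b^2)^(-1/2) that vanishes at v = 0; with it the
  second equation of the system reads F(v)_x = -2 u_y.\<close>

definition potential :: "real \<Rightarrow> real \<Rightarrow> real \<Rightarrow> real" where
  "potential b y v = arsinh (v / sqrt (y\<^sup>2 + b\<^sup>2))"

lemma potential_mono: "v \<le> w \<Longrightarrow> potential b y v \<le> potential b y w"
  unfolding potential_def
  by (metis arsinh_less_iff_real divide_right_mono leD leI real_sqrt_ge_zero sum_power2_ge_zero)

lemma potential_minus: "potential b y (- v) = - potential b y v"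
  by (simp add: potential_def)

lemma potential_reflect: "potential b (- y) v = potential b y v"
  by (simp add: potential_def)

lemma potential_has_derivative:
  assumes "b \<noteq> 0"
  shows "(potential b y has_real_derivative 1 / sqrt (v\<^sup>2 + y\<^sup>2 + b\<^sup>2)) (at v)"
proof -
  have pos: "y\<^sup>2 + b\<^sup>2 > 0" using assms by (simp add: add_nonneg_pos)
  have "sqrt ((v / sqrt (y\<^sup>2 + b\<^sup>2))\<^sup>2 + 1) * sqrt (y\<^sup>2 + b\<^sup>2) = sqrt (v\<^sup>2 + y\<^sup>2 + b\<^sup>2)"
    unfolding real_sqrt_mult[symmetric]
    using pos by (auto simp: power_divide add.assoc distrib_right)
  then have "1 / sqrt ((v / sqrt (y\<^sup>2 + b\<^sup>2))\<^sup>2 + 1) * (1 / sqrt (y\<^sup>2 + b\<^sup>2)) = 1 / sqrt (v\<^sup>2 + y\<^sup>2 + b\<^sup>2)"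
    by (simp add: divide_simps)
  moreover have "(potential b y has_real_derivative
      1 / sqrt ((v / sqrt (y\<^sup>2 + b\<^sup>2))\<^sup>2 + 1) * (1 / sqrt (y\<^sup>2 + b\<^sup>2))) (at v)"
    unfolding potential_def
    by (rule DERIV_chain2[OF arsinh_real_has_field_derivative DERIV_cdivide[OF DERIV_ident]])
  ultimately show ?thesis by simp
qed

lemma continuous_on_potential [continuous_intros]:
  assumes "b \<noteq> 0" "continuous_on A f"
  shows "continuous_on A (\<lambda>x. potential b y (f x))"
  unfolding potential_def using assms
  by (auto intro!: continuous_on_compose2[OF continuous_on_arsinh[of UNIV]] continuous_on_divide continuous_on_const)

text \<open>A Lipschitz constant uniform in b, at the price of its blow-up at y = 0.\<close>

lemma potential_diff_le:
  assumes "b \<noteq> 0" "0 < y" "w \<le> v"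
  shows "potential b y v - potential b y w \<le> (v - w) / y"
proof (cases "w = v")
  case False
  then have "w < v" using assms by simp
  then obtain z where z: "potential b y v - potential b y w = (v - w) * (1 / sqrt (z\<^sup>2 + y\<^sup>2 + b\<^sup>2))"
    using MVT2[of w v "potential b y" "\<lambda>z. 1 / sqrt (z\<^sup>2 + y\<^sup>2 + b\<^sup>2)"] potential_has_derivative[OF assms(1)]
    by blast
  have "y \<le> sqrt (z\<^sup>2 + y\<^sup>2 + b\<^sup>2)" by (rule real_le_rsqrt) simp
  then have "1 / sqrt (z\<^sup>2 + y\<^sup>2 + b\<^sup>2) \<le> 1 / y" using assms by (intro divide_left_mono mult_pos_pos) (auto simp: add_pos_nonneg add_nonneg_pos)
  then show ?thesis unfolding z using assms by (metis divide_inverse inverse_eq_divide mult_left_mono diff_ge_0_iff_ge)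
qed (use assms in auto)

text \<open>Any power of t below 1 would serve. With t of order 1 / |y|, a singularity |y|^(-p)
  integrated twice gives |y|^(2-p), which is of smaller order than |y| exactly when p < 1.\<close>

lemma arsinh_le_2_sqrt:
  assumes "0 \<le> t"
  shows "arsinh t \<le> 2 * sqrt t"
proof -
  have "sqrt (t\<^sup>2 + 1) \<le> t + 1" using assms by (intro real_le_lsqrt) (auto simp: power2_eq_square algebra_simps)
  \<comment> \<open>Already 1 + 2 t is below the quadratic Taylor polynomial of exp at 2 sqrt t,
    whose last term is 2 t.\<close>
  then have "t + sqrt (t\<^sup>2 + 1) \<le> 1 + 2 * sqrt t + (2 * sqrt t)\<^sup>2 / 2"
    using real_sqrt_ge_zero[OF assms] assms by (simp add: power_mult_distrib del: real_sqrt_ge_0_iff)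
  also have "\<dots> \<le> exp (2 * sqrt t)" using assms by (intro exp_lower_Taylor_quadratic) auto
  finally have "t + sqrt (t\<^sup>2 + 1) \<le> exp (2 * sqrt t)" .
  then show ?thesis unfolding arsinh_real_def
    using arsinh_real_aux[of t] by (metis ln_exp ln_mono)
qed

lemma potential_le:
  assumes "y \<noteq> 0" "0 \<le> M" "v \<le> M"
  shows "potential b y v \<le> 2 * sqrt (M / \<bar>y\<bar>)"
proof -
  have "\<bar>y\<bar> \<le> sqrt (y\<^sup>2 + b\<^sup>2)" by (rule real_le_rsqrt) simp
  then have "M / sqrt (y\<^sup>2 + b\<^sup>2) \<le> M / \<bar>y\<bar>"
    using assms by (intro divide_left_mono mult_pos_pos) (auto simp: add_pos_nonneg)
  have "potential b y v \<le> potential b y M" by (rule potential_mono) fact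
  also have "\<dots> \<le> 2 * sqrt (M / sqrt (y\<^sup>2 + b\<^sup>2))"
    unfolding potential_def using assms by (intro arsinh_le_2_sqrt) auto
  also have "\<dots> \<le> 2 * sqrt (M / \<bar>y\<bar>)" using \<open>M / _ \<le> M / _\<close> by simp
  finally show ?thesis .
qed

text \<open>This bound depends on b; it serves only the weak comparison principle, where b is
  fixed.\<close>

lemma potential_bounded:
  assumes "b \<noteq> 0" "\<bar>v\<bar> \<le> M"
  shows "\<bar>potential b y v\<bar> \<le> arsinh (M / \<bar>b\<bar>)"
proof -
  have "\<bar>b\<bar> \<le> sqrt (y\<^sup>2 + b\<^sup>2)" by (rule real_le_rsqrt) simp
  then have "M / sqrt (y\<^sup>2 + b\<^sup>2) \<le> M / \<bar>b\<bar>"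
    using assms by (intro divide_left_mono mult_pos_pos) (auto simp: add_nonneg_pos)
  then have M: "potential b y M \<le> arsinh (M / \<bar>b\<bar>)"
    unfolding potential_def by (meson arsinh_less_iff_real leD leI)
  have "potential b y v \<le> potential b y M" "potential b y (- v) \<le> potential b y M"
    using assms by (auto intro!: potential_mono)
  then show ?thesis using M by (simp add: potential_minus abs_le_iff)
qed

section \<open>From the first-order system to supersolutions\<close>

lemma mem_interior_strip:
  assumes "\<bar>y\<bar> < R"
  shows "(x, y) \<in> interior (strip R)"
proof -
  have "open {p :: real \<times> real. \<bar>snd p\<bar> < R}"
    by (intro open_Collect_less continuous_intros)
  moreover have "{p :: real \<times> real. \<bar>snd p\<bar> < R} \<subseteq> strip R" by (auto simp: strip_def)
  ultimately show ?thesis using assms by (auto simp: interior_def)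
qed

lemma dderiv_partial:
  assumes "f differentiable (at (x, y) within strip R)" "\<bar>y\<bar> < R"
  shows "((\<lambda>s. f (s, y)) has_real_derivative dderiv (strip R) ex f (x, y)) (at x)"
    and "((\<lambda>s. f (x, s)) has_real_derivative dderiv (strip R) ey f (x, y)) (at y)"
proof -
  have at: "at (x, y) within strip R = at (x, y)"
    by (rule at_within_interior[OF mem_interior_strip[OF assms(2)]])
  define D where "D = frechet_derivative f (at (x, y))"
  have D: "(f has_derivative D) (at (x, y))"
    using assms(1) unfolding at D_def frechet_derivative_works .
  then interpret D: bounded_linear D by (rule has_derivative_bounded_linear)
  have "((\<lambda>s. f (s, y)) has_derivative (\<lambda>s. D (s, 0))) (at x)"
    by (rule has_derivative_compose[of "\<lambda>s. (s, y)" _ _ _ f D])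
       (auto intro!: derivative_eq_intros D)
  moreover have "(\<lambda>s. D (s, 0)) = (*) (D ex)"
  proof
    fix s show "D (s, 0) = D ex * s"
      using D.scaleR[of s ex] by (simp add: ex_def mult.commute)
  qed
  ultimately show "((\<lambda>s. f (s, y)) has_real_derivative dderiv (strip R) ex f (x, y)) (at x)"
    by (simp add: has_field_derivative_def dderiv_def at D_def)
  have "((\<lambda>s. f (x, s)) has_derivative (\<lambda>s. D (0, s))) (at y)"
    by (rule has_derivative_compose[of "\<lambda>s. (x, s)" _ _ _ f D])
       (auto intro!: derivative_eq_intros D)
  moreover have "(\<lambda>s. D (0, s)) = (*) (D ey)"
  proof
    fix s show "D (0, s) = D ey * s"
      using D.scaleR[of s ey] by (simp add: ey_def mult.commute)
  qed
  ultimately show "((\<lambda>s. f (x, s)) has_real_derivative dderiv (strip R) ey f (x, y)) (at y)"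
    by (simp add: has_field_derivative_def dderiv_def at D_def)
qed

text \<open>The equation \<open>F(v)\<^sub>x\<^sub>x + 2 v\<^sub>y\<^sub>y = 0\<close>, with \<open>F\<close> the potential, is expressed by second differences,
  because this form survives taking infima of translates.\<close>

definition supersol :: "real \<Rightarrow> real \<Rightarrow> (real \<times> real \<Rightarrow> real) \<Rightarrow> bool" where
  "supersol b R v \<longleftrightarrow> (\<forall>X y \<epsilon>. \<bar>y\<bar> < R \<longrightarrow> \<epsilon> > 0 \<longrightarrow> (\<exists>k0>0. \<forall>k x. 0 < k \<longrightarrow> k < k0 \<longrightarrow> \<bar>x\<bar> \<le> X \<longrightarrow>
     sdiff (\<lambda>t. v (x, t)) k y + sdiff (\<lambda>s. potential b y (v (s, y))) k x / 2 \<le> \<epsilon> * k\<^sup>2))"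

text \<open>The first identity is the second equation of the system. The second is u_xy = v_yy after
  exchanging mixed derivatives; taking F(v)_xx from -2 u_y avoids differentiating the composite
  twice.\<close>

lemma solves_potential_derivatives:
  assumes b: "b \<noteq> 0" and Cu: "Ck 2 (strip R) {ex, ey} u" and Cv: "Ck 2 (strip R) {ex, ey} v"
    and sol: "solves b R u v (strip R)" and y: "\<bar>y\<bar> < R"
  defines "vyy \<equiv> dderiv (strip R) ey (dderiv (strip R) ey v)"
  shows "((\<lambda>s. potential b y (v (s, y))) has_real_derivative - 2 * dderiv (strip R) ey u (x, y)) (at x)"
    and "((\<lambda>s. - 2 * dderiv (strip R) ey u (s, y)) has_real_derivative - 2 * vyy (x, y)) (at x)"
proof -
  let ?T = "strip R"
  have inT: "(s, t) \<in> ?T" if "\<bar>t\<bar> < R" for s t using that by (auto simp: strip_def)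
  have du: "u differentiable (at p within ?T)" "dderiv ?T ex u differentiable (at p within ?T)"
      "dderiv ?T ey u differentiable (at p within ?T)" "v differentiable (at p within ?T)" if "p \<in> ?T" for p
    using Cu Cv that by (auto simp: numeral_2_eq_2)
  have cu: "continuous_on ?T (dderiv ?T ex (dderiv ?T ey u))" "continuous_on ?T (dderiv ?T ey (dderiv ?T ex u))"
    using Cu by (auto simp: numeral_2_eq_2)
  have eqs: "dderiv ?T ex u p = dderiv ?T ey v p"
      "dderiv ?T ex v p = - 2 * sqrt ((v p)\<^sup>2 + (snd p)\<^sup>2 + b\<^sup>2) * dderiv ?T ey u p" if "p \<in> ?T" for p
    using sol that by (auto simp: solves_def)
  have pos: "sqrt ((v (x, y))\<^sup>2 + y\<^sup>2 + b\<^sup>2) > 0" using b by (simp add: add_nonneg_pos)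
  have "((\<lambda>s. potential b y (v (s, y))) has_real_derivative
      1 / sqrt ((v (x, y))\<^sup>2 + y\<^sup>2 + b\<^sup>2) * dderiv ?T ex v (x, y)) (at x)"
    by (rule DERIV_chain2[OF potential_has_derivative[OF b] dderiv_partial(1)])
       (use y inT du in auto)
  moreover have "1 / sqrt ((v (x, y))\<^sup>2 + y\<^sup>2 + b\<^sup>2) * dderiv ?T ex v (x, y) = - 2 * dderiv ?T ey u (x, y)"
    using eqs(2)[OF inT[OF y]] pos by (simp add: field_simps)
  ultimately show "((\<lambda>s. potential b y (v (s, y))) has_real_derivative - 2 * dderiv ?T ey u (x, y)) (at x)"
    by simp
  have "dderiv ?T ey (dderiv ?T ex u) (x, y) = dderiv ?T ex (dderiv ?T ey u) (x, y)"
  proof (rule mixed_partials_commute[where f = u and r = "(R - \<bar>y\<bar>) / 2"])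
    have "\<bar>t\<bar> < R" if "\<bar>t - y\<bar> \<le> (R - \<bar>y\<bar>) / 2" for t
      using that y abs_triangle_ineq2[of t y] by argo
    note in' = this
    show "((\<lambda>s. u (s, t)) has_real_derivative dderiv ?T ex u (s, t)) (at s)"
      "((\<lambda>t. u (s, t)) has_real_derivative dderiv ?T ey u (s, t)) (at t)"
      "((\<lambda>t. dderiv ?T ex u (s, t)) has_real_derivative dderiv ?T ey (dderiv ?T ex u) (s, t)) (at t)"
      "((\<lambda>s. dderiv ?T ey u (s, t)) has_real_derivative dderiv ?T ex (dderiv ?T ey u) (s, t)) (at s)"
      if "\<bar>t - y\<bar> \<le> (R - \<bar>y\<bar>) / 2" for s t
      using in'[OF that] inT by (auto intro!: dderiv_partial du)
    show "isCont (dderiv ?T ey (dderiv ?T ex u)) (x, y)" "isCont (dderiv ?T ex (dderiv ?T ey u)) (x, y)"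
      using continuous_on_interior[OF cu(1) mem_interior_strip[OF y]]
        continuous_on_interior[OF cu(2) mem_interior_strip[OF y]] by auto
  qed (use y in auto)
  \<comment> \<open>The equation u_x = v_y holds on a neighbourhood in y, so it may be
    differentiated in y.\<close>
  moreover have "dderiv ?T ey (dderiv ?T ex u) (x, y) = vyy (x, y)"
  proof -
    have "((\<lambda>t. dderiv ?T ex u (x, t)) has_real_derivative vyy (x, y)) (at y)"
    proof (rule DERIV_cong_ev[OF refl _ refl, THEN iffD2])
      have "\<forall>\<^sub>F t in nhds y. t \<in> {-R<..<R}"
        by (rule eventually_nhds_in_open) (use y in auto)
      then show "\<forall>\<^sub>F t in nhds y. dderiv ?T ex u (x, t) = dderiv ?T ey v (x, t)"
        by eventually_elim (use eqs(1) inT in auto)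
      show "((\<lambda>t. dderiv ?T ey v (x, t)) has_real_derivative vyy (x, y)) (at y)"
        unfolding vyy_def using Cv y inT[OF y]
        by (intro dderiv_partial(2)) (auto simp: numeral_2_eq_2)
    qed
    then show ?thesis
      using dderiv_partial(2)[OF du(2) y, OF inT[OF y]] DERIV_unique by blast
  qed
  moreover have "((\<lambda>s. - 2 * dderiv ?T ey u (s, y)) has_real_derivative - 2 * dderiv ?T ex (dderiv ?T ey u) (x, y)) (at x)"
    by (intro DERIV_cmult dderiv_partial(1) du y inT)
  ultimately show "((\<lambda>s. - 2 * dderiv ?T ey u (s, y)) has_real_derivative - 2 * vyy (x, y)) (at x)"
    by simp
qed

text \<open>The second differences are k^2 v_yy(x, \<xi>) and -2 k^2 v_yy(\<eta>, y) with both
  points within k of (x, y). Their combination is k^2 times an oscillation of v_yy, small uniformly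
  in |x| <= X by uniform continuity on a compact box.\<close>

lemma solves_sdiff_le:
  assumes b: "b \<noteq> 0" and Cu: "Ck 2 (strip R) {ex, ey} u" and Cv: "Ck 2 (strip R) {ex, ey} v"
    and sol: "solves b R u v (strip R)" and y: "\<bar>y\<bar> < R" and e: "e > 0"
  shows "\<exists>k0>0. \<forall>k x. 0 < k \<longrightarrow> k < k0 \<longrightarrow> \<bar>x\<bar> \<le> X \<longrightarrow>
    \<bar>sdiff (\<lambda>t. v (x, t)) k y + sdiff (\<lambda>s. potential b y (v (s, y))) k x / 2\<bar> \<le> e * k\<^sup>2"
proof -
  let ?T = "strip R"
  define vyy where "vyy = dderiv ?T ey (dderiv ?T ey v)"
  have inT: "(s, t) \<in> ?T" if "\<bar>t\<bar> < R" for s t using that by (auto simp: strip_def)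
  define r where "r = (R - \<bar>y\<bar>) / 2"
  have r: "r > 0" using y by (simp add: r_def)
  have rR: "\<bar>t\<bar> < R" if "\<bar>t - y\<bar> \<le> r" for t
    using that y abs_triangle_ineq2[of t y] unfolding r_def by argo
  define K where "K = cbox (- X - 1, y - r) (X + 1, y + r)"
  have K: "(s, t) \<in> K" if "\<bar>s\<bar> \<le> X + 1" "\<bar>t - y\<bar> \<le> r" for s t
    using that by (auto simp: K_def cbox_Pair_eq)
  have "K \<subseteq> ?T"
  proof
    fix p assume "p \<in> K"
    then have "\<bar>snd p - y\<bar> \<le> r" by (auto simp: K_def cbox_Pair_eq)
    from rR[OF this] show "p \<in> ?T" by (simp add: strip_def)
  qed
  then have "continuous_on K vyy"
    using Cv by (auto simp: numeral_2_eq_2 vyy_def intro: continuous_on_subset)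
  then have "uniformly_continuous_on K vyy"
    by (rule compact_uniformly_continuous) (simp add: K_def)
  then obtain d where d: "d > 0" "\<And>p q. \<lbrakk>p \<in> K; q \<in> K; dist p q < d\<rbrakk> \<Longrightarrow> dist (vyy p) (vyy q) < e"
    using e unfolding uniformly_continuous_on_def by (metis dist_commute)
  \<comment> \<open>The points (x, \<xi>) and (\<eta>, y) are less than 2 k apart, hence
    \<open>d / 2\<close>; 1 and \<open>r\<close> keep them in \<open>K\<close>.\<close>
  define k0 where "k0 = min (min 1 r) (d / 2)"
  show ?thesis
  proof (intro exI[of _ k0] conjI allI impI)
    show "k0 > 0" using r d by (simp add: k0_def)
    fix k x assume k: "0 < k" "k < k0" and x: "\<bar>x\<bar> \<le> X"
    have k': "k < 1" "k < r" "2 * k < d" using k by (auto simp: k0_def)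
    have "\<exists>\<xi>. \<bar>\<xi> - y\<bar> < k \<and> sdiff (\<lambda>t. v (x, t)) k y = k\<^sup>2 * vyy (x, \<xi>)"
    proof (rule sdiff_mvt[OF k(1)])
      fix s assume "\<bar>s - y\<bar> \<le> k"
      then have s: "\<bar>s\<bar> < R" using rR[of s] k' by simp
      show "((\<lambda>t. v (x, t)) has_real_derivative dderiv ?T ey v (x, s)) (at s)"
        "((\<lambda>s. dderiv ?T ey v (x, s)) has_real_derivative vyy (x, s)) (at s)"
        unfolding vyy_def using Cv inT[OF s] s
        by (auto intro!: dderiv_partial simp: numeral_2_eq_2)
    qed
    then obtain \<xi> where \<xi>: "\<bar>\<xi> - y\<bar> < k" "sdiff (\<lambda>t. v (x, t)) k y = k\<^sup>2 * vyy (x, \<xi>)" by auto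
    have "\<exists>\<xi>. \<bar>\<xi> - x\<bar> < k \<and> sdiff (\<lambda>s. potential b y (v (s, y))) k x = k\<^sup>2 * (- 2 * vyy (\<xi>, y))"
      by (rule sdiff_mvt[OF k(1)])
         (use solves_potential_derivatives[OF b Cu Cv sol y] in \<open>auto simp: vyy_def\<close>)
    then obtain \<eta> where \<eta>: "\<bar>\<eta> - x\<bar> < k"
        "sdiff (\<lambda>s. potential b y (v (s, y))) k x = k\<^sup>2 * (- 2 * vyy (\<eta>, y))" by auto
    have "dist (x, \<xi>) (\<eta>, y) \<le> \<bar>x - \<eta>\<bar> + \<bar>\<xi> - y\<bar>"
      using norm_Pair_le[of "x - \<eta>" "\<xi> - y"] by (simp add: dist_norm)
    then have "dist (vyy (x, \<xi>)) (vyy (\<eta>, y)) < e"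
      using \<xi> \<eta> k' x r by (intro d(2) K) auto
    then have "\<bar>k\<^sup>2 * (vyy (x, \<xi>) - vyy (\<eta>, y))\<bar> \<le> k\<^sup>2 * e"
      unfolding abs_mult dist_real_def by (intro mult_mono) auto
    then show "\<bar>sdiff (\<lambda>t. v (x, t)) k y + sdiff (\<lambda>s. potential b y (v (s, y))) k x / 2\<bar> \<le> e * k\<^sup>2"
      unfolding \<xi>(2) \<eta>(2) by (simp add: algebra_simps)
  qed
qed

lemma solves_imp_supersol:
  assumes "b \<noteq> 0" "Ck 2 (strip R) {ex, ey} u" "Ck 2 (strip R) {ex, ey} v" "solves b R u v (strip R)"
  shows "supersol b R v" and "supersol b R (\<lambda>p. - v p)"
proof -
  have m: "sdiff (\<lambda>t. - f t) k x = - sdiff f k x" for f k x by (simp add: sdiff_def)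
  show "supersol b R v"
    unfolding supersol_def
  proof (intro allI impI)
    fix X y e :: real assume "\<bar>y\<bar> < R" "e > 0"
    from solves_sdiff_le[OF assms this, of X] obtain k0 where "k0 > 0" and
      k0: "\<And>k x. \<lbrakk>0 < k; k < k0; \<bar>x\<bar> \<le> X\<rbrakk> \<Longrightarrow>
        \<bar>sdiff (\<lambda>t. v (x, t)) k y + sdiff (\<lambda>s. potential b y (v (s, y))) k x / 2\<bar> \<le> e * k\<^sup>2"
      by blast
    then show "\<exists>k0>0. \<forall>k x. 0 < k \<longrightarrow> k < k0 \<longrightarrow> \<bar>x\<bar> \<le> X \<longrightarrow>
        sdiff (\<lambda>t. v (x, t)) k y + sdiff (\<lambda>s. potential b y (v (s, y))) k x / 2 \<le> e * k\<^sup>2"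
      by (meson abs_le_D1)
  qed
  show "supersol b R (\<lambda>p. - v p)"
    unfolding supersol_def
  proof (intro allI impI)
    fix X y e :: real assume "\<bar>y\<bar> < R" "e > 0"
    from solves_sdiff_le[OF assms this, of X] obtain k0 where "k0 > 0" and
      k0: "\<And>k x. \<lbrakk>0 < k; k < k0; \<bar>x\<bar> \<le> X\<rbrakk> \<Longrightarrow>
        \<bar>sdiff (\<lambda>t. v (x, t)) k y + sdiff (\<lambda>s. potential b y (v (s, y))) k x / 2\<bar> \<le> e * k\<^sup>2"
      by blast
    have "sdiff (\<lambda>t. - v (x, t)) k y + sdiff (\<lambda>s. potential b y (- v (s, y))) k x / 2 \<le> e * k\<^sup>2"
      if "0 < k" "k < k0" "\<bar>x\<bar> \<le> X" for k x
      using abs_le_D2[OF k0[OF that]] by (simp add: potential_minus m)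
    then show "\<exists>k0>0. \<forall>k x. 0 < k \<longrightarrow> k < k0 \<longrightarrow> \<bar>x\<bar> \<le> X \<longrightarrow>
        sdiff (\<lambda>t. - v (x, t)) k y + sdiff (\<lambda>s. potential b y (- v (s, y))) k x / 2 \<le> e * k\<^sup>2"
      using \<open>k0 > 0\<close> by blast
  qed
qed

section \<open>Infima of translates and reflection\<close>

definition inf_translates :: "real \<Rightarrow> (real \<times> real \<Rightarrow> real) \<Rightarrow> real \<times> real \<Rightarrow> real" where
  "inf_translates s v p = (INF t\<in>{-s..s}. v (fst p + t, snd p))"

lemma inf_translates_attained:
  assumes "continuous_on (strip R) v" "0 \<le> s" "\<bar>y\<bar> \<le> R"
  obtains t where "\<bar>t\<bar> \<le> s" "inf_translates s v (x, y) = v (x + t, y)"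
    "\<And>t'. \<bar>t'\<bar> \<le> s \<Longrightarrow> v (x + t, y) \<le> v (x + t', y)"
proof -
  have "continuous_on {-s..s} (\<lambda>t. v (x + t, y))"
    using assms(3) by (intro continuous_on_compose2[OF assms(1)] continuous_intros) (auto simp: strip_def)
  then obtain t where t: "t \<in> {-s..s}" "\<And>t'. t' \<in> {-s..s} \<Longrightarrow> v (x + t, y) \<le> v (x + t', y)"
    using continuous_attains_inf[OF compact_Icc, of "-s" s] assms(2) by force
  have "inf_translates s v (x, y) = v (x + t, y)"
    unfolding inf_translates_def fst_conv snd_conv
    by (rule cInf_eq_minimum) (use t in auto)
  then show ?thesis using t by (intro that[of t]) (auto simp: abs_le_iff)
qed

lemma inf_translates_le:
  assumes "continuous_on (strip R) v" "\<bar>t\<bar> \<le> s" "\<bar>y\<bar> \<le> R"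
  shows "inf_translates s v (x, y) \<le> v (x + t, y)"
proof -
  have "0 \<le> s" using assms(2) by linarith
  from inf_translates_attained[OF assms(1) this assms(3)] show ?thesis
    using assms(2) by metis
qed

text \<open>A minimising shift at one point is an admissible competitor at the other, and a common
  shift keeps the distance of two points, so the infimum inherits the modulus of continuity of
  \<open>v\<close> on a compact box.\<close>

lemma continuous_on_inf_translates:
  assumes v: "continuous_on (strip R) v" and s: "0 \<le> s"
  shows "continuous_on (strip R) (inf_translates s v)"
  unfolding continuous_on_iff
proof (intro ballI allI impI)
  fix p :: "real \<times> real" and e :: real assume p: "p \<in> strip R" and e: "0 < e"
  obtain x y where xy: "p = (x, y)" by force
  have y: "\<bar>y\<bar> \<le> R" using p by (simp add: strip_def xy)
  define K where "K = cbox (x - 1 - s, - R) (x + 1 + s, R)"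
  have "K \<subseteq> strip R" by (auto simp: K_def strip_def cbox_Pair_eq)
  then have "uniformly_continuous_on K v"
    by (intro compact_uniformly_continuous continuous_on_subset[OF v]) (auto simp: K_def)
  then obtain d where d: "d > 0" "\<And>p q. \<lbrakk>p \<in> K; q \<in> K; dist p q < d\<rbrakk> \<Longrightarrow> dist (v p) (v q) < e"
    using e unfolding uniformly_continuous_on_def by metis
  show "\<exists>d>0. \<forall>q\<in>strip R. dist q p < d \<longrightarrow> dist (inf_translates s v q) (inf_translates s v p) < e"
  proof (intro exI[of _ "min 1 d"] conjI ballI impI)
    show "0 < min 1 d" using d by simp
    fix q :: "real \<times> real" assume q: "q \<in> strip R" "dist q p < min 1 d"
    obtain x' y' where xy': "q = (x', y')" by force
    have y': "\<bar>y'\<bar> \<le> R" using q by (simp add: strip_def xy')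
    have "dist x' x \<le> dist q p" unfolding xy xy' by (metis dist_fst_le fst_conv)
    then have x': "\<bar>x' - x\<bar> < 1" using q(2) by (simp add: dist_real_def)
    have near: "\<bar>v (x' + t, y') - v (x + t, y)\<bar> < e" if "\<bar>t\<bar> \<le> s" for t
    proof -
      have "dist (x' + t, y') (x + t, y) = dist q p" by (simp add: xy xy' dist_Pair_Pair dist_real_def)
      then show ?thesis using d(2)[of "(x' + t, y')" "(x + t, y)"] q(2) that y y' x'
        by (auto simp: K_def cbox_Pair_eq dist_real_def abs_le_iff abs_less_iff)
    qed
    obtain t where t: "\<bar>t\<bar> \<le> s" "inf_translates s v p = v (x + t, y)"
      using inf_translates_attained[OF v s y, of x] unfolding xy by metis
    obtain t' where t': "\<bar>t'\<bar> \<le> s" "inf_translates s v q = v (x' + t', y')"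
      using inf_translates_attained[OF v s y', of x'] unfolding xy' by metis
    have "inf_translates s v q \<le> v (x' + t, y')" "inf_translates s v p \<le> v (x + t', y)"
      unfolding xy xy' using t t' y y' by (auto intro!: inf_translates_le[OF v])
    then show "dist (inf_translates s v q) (inf_translates s v p) < e"
      using near[OF t(1)] near[OF t'(1)] t t' unfolding dist_real_def by linarith
  qed
qed

text \<open>With \<open>t\<close> a minimising shift at (x, y), the infimum touches the translate by
  \<open>t\<close> from below there, so its second differences are no larger; as F is increasing in
  v, so are those of the potentials. The equation does not involve x, hence translates are
  supersolutions too; the shift enlarges the range of x from \<open>X\<close> to
  \<open>X + s\<close>, which the uniformity over bounded x in \<open>supersol\<close>
  absorbs.\<close>

lemma supersol_inf_translates:
  assumes v: "continuous_on (strip R) v" and s: "0 \<le> s" and sup: "supersol b R v"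
  shows "supersol b R (inf_translates s v)"
  unfolding supersol_def
proof (intro allI impI)
  fix X y e :: real assume y: "\<bar>y\<bar> < R" and e: "e > 0"
  obtain k0 where "k0 > 0" and
    k0: "\<And>k x. \<lbrakk>0 < k; k < k0; \<bar>x\<bar> \<le> X + s\<rbrakk> \<Longrightarrow>
      sdiff (\<lambda>t. v (x, t)) k y + sdiff (\<lambda>s. potential b y (v (s, y))) k x / 2 \<le> e * k\<^sup>2"
    using sup y e unfolding supersol_def by blast
  let ?V = "inf_translates s v"
  show "\<exists>k0>0. \<forall>k x. 0 < k \<longrightarrow> k < k0 \<longrightarrow> \<bar>x\<bar> \<le> X \<longrightarrow>
      sdiff (\<lambda>t. ?V (x, t)) k y + sdiff (\<lambda>s. potential b y (?V (s, y))) k x / 2 \<le> e * k\<^sup>2"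
  proof (intro exI[of _ "min k0 (R - \<bar>y\<bar>)"] conjI allI impI)
    show "0 < min k0 (R - \<bar>y\<bar>)" using \<open>k0 > 0\<close> y by simp
    fix k x assume k: "0 < k" "k < min k0 (R - \<bar>y\<bar>)" and x: "\<bar>x\<bar> \<le> X"
    have yk: "\<bar>y + k\<bar> \<le> R" "\<bar>y - k\<bar> \<le> R" "\<bar>y\<bar> \<le> R" using k y by auto
    obtain t where t: "\<bar>t\<bar> \<le> s" "?V (x, y) = v (x + t, y)"
      using inf_translates_attained[OF v s yk(3)] by metis
    note le = inf_translates_le[OF v t(1)]
    have "sdiff (\<lambda>r. ?V (x, r)) k y \<le> sdiff (\<lambda>r. v (x + t, r)) k y"
      unfolding sdiff_def using le[OF yk(1), of x] le[OF yk(2), of x] t(2) by simp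
    moreover have "sdiff (\<lambda>r. potential b y (?V (r, y))) k x \<le> sdiff (\<lambda>r. potential b y (v (r, y))) k (x + t)"
      unfolding sdiff_def
      using potential_mono[OF le[OF yk(3), of "x + k"], of b y] potential_mono[OF le[OF yk(3), of "x - k"], of b y] t(2)
      by (simp add: algebra_simps)
    moreover have "sdiff (\<lambda>r. v (x + t, r)) k y + sdiff (\<lambda>r. potential b y (v (r, y))) k (x + t) / 2 \<le> e * k\<^sup>2"
      using k0[of k "x + t"] k x t by simp
    ultimately show "sdiff (\<lambda>r. ?V (x, r)) k y + sdiff (\<lambda>r. potential b y (?V (r, y))) k x / 2 \<le> e * k\<^sup>2"
      by linarith
  qed
qed

text \<open>F depends on y only through y^2. This transfers estimates from y > 0 to y < 0.\<close>

lemma supersol_reflect: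
  assumes "supersol b R v"
  shows "supersol b R (\<lambda>p. v (fst p, - snd p))"
  unfolding supersol_def
proof (intro allI impI)
  fix X y e :: real assume y: "\<bar>y\<bar> < R" and e: "e > 0"
  then have "\<bar>- y\<bar> < R" by simp
  from assms[unfolded supersol_def, rule_format, OF this e, of X]
  show "\<exists>k0>0. \<forall>k x. 0 < k \<longrightarrow> k < k0 \<longrightarrow> \<bar>x\<bar> \<le> X \<longrightarrow>
      sdiff (\<lambda>t. v (fst (x, t), - snd (x, t))) k y
      + sdiff (\<lambda>s. potential b y (v (fst (s, y), - snd (s, y)))) k x / 2 \<le> e * k\<^sup>2"
    by (simp add: sdiff_def potential_reflect algebra_simps minus_diff_commute)
qed

section \<open>Integration in x against a compactly supported weight\<close>

lemma integrable_weight: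
  fixes \<phi> g :: "real \<Rightarrow> real"
  assumes "continuous_on UNIV \<phi>" "\<And>x. A < \<bar>x\<bar> \<Longrightarrow> \<phi> x = 0" "continuous_on UNIV g"
  shows "integrable lborel (\<lambda>x. \<phi> x * g x)"
proof -
  have "integrable lborel (\<lambda>x. indicator {-A..A} x *\<^sub>R (\<phi> x * g x))"
    by (intro borel_integrable_compact continuous_intros compact_Icc)
       (auto intro: continuous_on_subset assms)
  moreover have "(\<lambda>x. indicator {-A..A} x *\<^sub>R (\<phi> x * g x)) = (\<lambda>x. \<phi> x * g x)"
  proof
    fix x show "indicator {-A..A} x *\<^sub>R (\<phi> x * g x) = \<phi> x * g x"
      using assms(2)[of x] by (cases "x \<in> {-A..A}") (auto simp: abs_if split: if_splits)
  qed
  ultimately show ?thesis by simp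
qed

lemma integrable_const_on_Icc: "integrable lborel (\<lambda>x::real. c * indicator {a..b} x :: real)"
  by (intro integrable_mult_right integrable_real_indicator) (auto simp: emeasure_lborel_Icc_eq)

text \<open>Discrete integration by parts: translation invariance of Lebesgue measure makes the
  second difference a symmetric operator.\<close>

lemma weight_sdiff_swap:
  fixes \<phi> g :: "real \<Rightarrow> real"
  assumes \<phi>: "continuous_on UNIV \<phi>" "\<And>x. A < \<bar>x\<bar> \<Longrightarrow> \<phi> x = 0" and g: "continuous_on UNIV g"
  shows "(LINT x|lborel. \<phi> x * sdiff g k x) = (LINT x|lborel. sdiff \<phi> k x * g x)"
proof -
  have sh: "continuous_on UNIV (\<lambda>x. h (x + c))" if "continuous_on UNIV h" for h :: "real \<Rightarrow> real" and c
    by (intro continuous_on_compose2[OF that] continuous_intros) auto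
  have I1: "integrable lborel (\<lambda>x. \<phi> x * g (x + c))" for c
    by (rule integrable_weight[OF \<phi> sh[OF g]])
  have z: "\<phi> (x + c) = 0" if "A + \<bar>c\<bar> < \<bar>x\<bar>" for x c using that by (intro \<phi>(2)) linarith
  have I2: "integrable lborel (\<lambda>x. \<phi> (x + c) * g x)" for c
    by (rule integrable_weight[OF sh[OF \<phi>(1)] z g])
  have shift: "(LINT x|lborel. \<phi> x * g (x + c)) = (LINT x|lborel. \<phi> (x - c) * g x)" for c
    using lborel_integral_real_affine[of 1 "\<lambda>x. \<phi> (x - c) * g x" c] by (simp add: add.commute)
  have "(LINT x|lborel. \<phi> x * sdiff g k x) = (LINT x|lborel. \<phi> x * g (x + k) + \<phi> x * g (x + - k) - 2 * (\<phi> x * g (x + 0)))"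
    by (rule Bochner_Integration.integral_cong) (auto simp: sdiff_def algebra_simps)
  also have "\<dots> = (LINT x|lborel. \<phi> x * g (x + k)) + (LINT x|lborel. \<phi> x * g (x + - k)) - 2 * (LINT x|lborel. \<phi> x * g (x + 0))"
    using I1[of k] I1[of "-k"] I1[of 0]
    by simp
  also have "\<dots> = (LINT x|lborel. \<phi> (x + - k) * g x) + (LINT x|lborel. \<phi> (x + k) * g x) - 2 * (LINT x|lborel. \<phi> (x + 0) * g x)"
    unfolding shift by simp
  also have "\<dots> = (LINT x|lborel. \<phi> (x + - k) * g x + \<phi> (x + k) * g x - 2 * (\<phi> (x + 0) * g x))"
    using I2[of k] I2[of "-k"] I2[of 0]
    by simp
  also have "\<dots> = (LINT x|lborel. sdiff \<phi> k x * g x)"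
    by (rule Bochner_Integration.integral_cong) (auto simp: sdiff_def algebra_simps)
  finally show ?thesis .
qed

lemma continuous_on_slice:
  assumes "continuous_on (strip R) f" "\<bar>y\<bar> \<le> R"
  shows "continuous_on UNIV (\<lambda>x. f (x, y))"
  by (intro continuous_on_compose2[OF assms(1)] continuous_intros) (use assms(2) in \<open>auto simp: strip_def\<close>)

lemma continuous_on_weight_integral:
  fixes \<phi> :: "real \<Rightarrow> real"
  assumes \<phi>: "continuous_on UNIV \<phi>" "\<And>x. A < \<bar>x\<bar> \<Longrightarrow> \<phi> x = 0"
    and f: "continuous_on (strip R) f" "\<And>p. p \<in> strip R \<Longrightarrow> \<bar>f p\<bar> \<le> M"
  shows "continuous_on {-R..R} (\<lambda>y. LINT x|lborel. \<phi> x * f (x, y))"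
  unfolding continuous_on_sequentially
proof (intro allI ballI impI)
  fix Y :: "nat \<Rightarrow> real" and y assume y: "y \<in> {-R..R}" and Y: "(\<forall>n. Y n \<in> {-R..R}) \<and> Y \<longlonglongrightarrow> y"
  have inS: "(x, t) \<in> strip R" if "t \<in> {-R..R}" for x t using that by (auto simp: strip_def)
  have int: "integrable lborel (\<lambda>x. \<phi> x * f (x, t))" if "t \<in> {-R..R}" for t
    by (rule integrable_weight[OF \<phi> continuous_on_slice[OF f(1)]]) (use that in auto)
  show "((\<lambda>y. LINT x|lborel. \<phi> x * f (x, y)) \<circ> Y) \<longlonglongrightarrow> (LINT x|lborel. \<phi> x * f (x, y))"
    unfolding o_def
  proof (rule integral_dominated_convergence[where w = "\<lambda>x. \<bar>\<phi> x\<bar> * M"])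
    show "integrable lborel (\<lambda>x. \<bar>\<phi> x\<bar> * M)"
      by (rule integrable_weight[where A = A]) (auto intro!: continuous_intros \<phi>)
    show "AE x in lborel. (\<lambda>n. \<phi> x * f (x, Y n)) \<longlonglongrightarrow> \<phi> x * f (x, y)"
    proof (intro AE_I2 tendsto_intros)
      fix x :: real
      have "(\<lambda>n. (x, Y n)) \<longlonglongrightarrow> (x, y)" using Y by (intro tendsto_intros) auto
      then show "(\<lambda>n. f (x, Y n)) \<longlonglongrightarrow> f (x, y)"
        using f(1) inS Y y unfolding continuous_on_sequentially by (auto simp: o_def)
    qed
    fix n :: nat show "AE x in lborel. norm (\<phi> x * f (x, Y n)) \<le> \<bar>\<phi> x\<bar> * M"
      using f(2) inS Y by (auto simp: abs_mult intro!: mult_left_mono)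
  qed (use int y Y in auto)
qed

section \<open>The weak comparison principle\<close>

text \<open>As F is odd, this is F(V) - F(-N), comparing a supersolution V with a subsolution
  -N.\<close>

definition pot_sum :: "real \<Rightarrow> (real \<times> real \<Rightarrow> real) \<Rightarrow> (real \<times> real \<Rightarrow> real) \<Rightarrow> real \<times> real \<Rightarrow> real" where
  "pot_sum b V N p = potential b (snd p) (V p) + potential b (snd p) (N p)"

lemma pot_sum_nonneg: "0 \<le> V p + N p \<Longrightarrow> 0 \<le> pot_sum b V N p"
  using potential_mono[of "- N p" "V p" b "snd p"] by (simp add: pot_sum_def potential_minus)

lemma pot_sum_nonpos: "V p + N p \<le> 0 \<Longrightarrow> pot_sum b V N p \<le> 0"
  using potential_mono[of "V p" "- N p" b "snd p"] by (simp add: pot_sum_def potential_minus)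

lemma pot_sum_bounded:
  assumes "b \<noteq> 0" "\<bar>V p\<bar> \<le> M" "\<bar>N p\<bar> \<le> M"
  shows "\<bar>pot_sum b V N p\<bar> \<le> 2 * arsinh (M / \<bar>b\<bar>)"
  using potential_bounded[OF assms(1,2), of "snd p"] potential_bounded[OF assms(1,3), of "snd p"]
  unfolding pot_sum_def by linarith

lemma continuous_on_pot_sum_slice:
  assumes "b \<noteq> 0" "continuous_on (strip R) V" "continuous_on (strip R) N" "\<bar>y\<bar> \<le> R"
  shows "continuous_on UNIV (\<lambda>x. pot_sum b V N (x, y))"
  unfolding pot_sum_def snd_conv using assms
  by (intro continuous_intros continuous_on_slice[of R])

lemma supersol_sum:
  assumes "supersol b R V" "supersol b R N" "\<bar>y\<bar> < R" "0 < e"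
  obtains k0 where "0 < k0" "k0 \<le> 1" "k0 \<le> R - \<bar>y\<bar>"
    "\<And>k x. \<lbrakk>0 < k; k < k0; \<bar>x\<bar> \<le> X\<rbrakk> \<Longrightarrow>
      sdiff (\<lambda>t. V (x, t) + N (x, t)) k y + sdiff (\<lambda>s. pot_sum b V N (s, y)) k x / 2 \<le> e * k\<^sup>2"
proof -
  have e: "e / 2 > 0" using assms by simp
  obtain k1 where k1: "k1 > 0" "\<And>k x. \<lbrakk>0 < k; k < k1; \<bar>x\<bar> \<le> X\<rbrakk> \<Longrightarrow>
      sdiff (\<lambda>t. V (x, t)) k y + sdiff (\<lambda>s. potential b y (V (s, y))) k x / 2 \<le> e / 2 * k\<^sup>2"
    using assms(1)[unfolded supersol_def, rule_format, OF assms(3) e] by metis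
  obtain k2 where k2: "k2 > 0" "\<And>k x. \<lbrakk>0 < k; k < k2; \<bar>x\<bar> \<le> X\<rbrakk> \<Longrightarrow>
      sdiff (\<lambda>t. N (x, t)) k y + sdiff (\<lambda>s. potential b y (N (s, y))) k x / 2 \<le> e / 2 * k\<^sup>2"
    using assms(2)[unfolded supersol_def, rule_format, OF assms(3) e] by metis
  have "sdiff (\<lambda>t. V (x, t) + N (x, t)) k y + sdiff (\<lambda>s. pot_sum b V N (s, y)) k x / 2 \<le> e * k\<^sup>2"
    if "0 < k" "k < k1" "k < k2" "\<bar>x\<bar> \<le> X" for k x
    using k1(2)[of k x] k2(2)[of k x] that by (simp add: sdiff_def pot_sum_def field_simps)
  then show ?thesis
    using k1(1) k2(1) assms(3) by (intro that[of "min (min k1 k2) (min 1 (R - \<bar>y\<bar>))"]) auto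
qed

definition tent2 :: "real \<Rightarrow> real \<Rightarrow> real" where
  "tent2 L x = (max 0 (L - \<bar>x\<bar>))\<^sup>2"

lemma continuous_on_tent2: "continuous_on A (tent2 L)"
  unfolding tent2_def by (intro continuous_intros)

text \<open>For L > 0 the function is C^1 at |x| = L, its second derivative is 2 or 0 where it
  exists, and its kink at the origin is concave, which only lowers second differences. In the proof
  the concavity appears as \<open>h1 + h2\<close> being at most 0.\<close>

lemma sdiff_tent2_le:
  assumes "0 \<le> k"
  shows "sdiff (tent2 L) k x \<le> 2 * k\<^sup>2"
proof -
  define z where "z = max 0 (L - \<bar>x\<bar>)"
  define h1 where "h1 = \<bar>x\<bar> - \<bar>x + k\<bar>"
  define h2 where "h2 = \<bar>x\<bar> - \<bar>x - k\<bar>"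
  have "tent2 L (x + k) \<le> (z + h1)\<^sup>2" "tent2 L (x - k) \<le> (z + h2)\<^sup>2"
    unfolding tent2_def by (rule abs_le_square_iff[THEN iffD1]; simp add: z_def h1_def h2_def)+
  moreover have "h1\<^sup>2 \<le> k\<^sup>2" "h2\<^sup>2 \<le> k\<^sup>2"
    using assms by (auto simp: h1_def h2_def abs_le_square_iff[symmetric])
  moreover have "z * (h1 + h2) \<le> 0"
    by (intro mult_nonneg_nonpos) (auto simp: z_def h1_def h2_def)
  moreover have "tent2 L x = z\<^sup>2" by (simp add: tent2_def z_def)
  ultimately show ?thesis by (simp add: sdiff_def power2_sum algebra_simps)
qed

text \<open>The weight has size \<open>L\<^sup>2\<close> near the origin but the bound grows only linearly in \<open>L\<close>, so letting
  \<open>L\<close> tend to infinity forces the negative part to vanish.\<close>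

lemma comparison_weighted:
  assumes b: "b \<noteq> 0" and V: "continuous_on (strip R) V" and N: "continuous_on (strip R) N"
    and bV: "\<And>p. p \<in> strip R \<Longrightarrow> \<bar>V p\<bar> \<le> M" and bN: "\<And>p. p \<in> strip R \<Longrightarrow> \<bar>N p\<bar> \<le> M"
    and sV: "supersol b R V" and sN: "supersol b R N"
    and bd: "\<And>x. 0 \<le> V (x, R) + N (x, R)" "\<And>x. 0 \<le> V (x, -R) + N (x, -R)"
    and L: "0 \<le> L" and y: "\<bar>y\<bar> \<le> R"
  shows "(LINT x|lborel. tent2 L x * max 0 (- (V (x, y) + N (x, y))))
    \<le> (4 * arsinh (M / \<bar>b\<bar>) * (L + 1) + 1) * R\<^sup>2"
proof -
  \<comment> \<open>\<open>W\<close> and \<open>G\<close> are the negative parts of V + N and of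
    F(V) - F(-N); both vanish where V + N >= 0.\<close>
  define W where "W p = max 0 (- (V p + N p))" for p
  define G where "G p = max 0 (- pot_sum b V N p)" for p
  define B where "B = 2 * arsinh (M / \<bar>b\<bar>)"
  define J where "J = (LINT x|lborel. tent2 L x)"
  define I where "I t = (LINT x|lborel. tent2 L x * W (x, t))" for t
  \<comment> \<open>Per k^2: the weight has second difference at most 2 on an interval of length 2
    (L + 1) and G <= B, so half of the integral is at most 2 B (L + 1). The summand 1 absorbs e
    J.\<close>
  define K where "K = 2 * B * (L + 1) + 1"
  have inS: "(x, t) \<in> strip R" if "\<bar>t\<bar> \<le> R" for x t using that by (simp add: strip_def)
  have R: "0 \<le> R" using y by linarith
  have \<phi>: "continuous_on UNIV (tent2 L)" "\<And>x. L < \<bar>x\<bar> \<Longrightarrow> tent2 L x = 0"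
    by (auto simp: continuous_on_tent2) (simp add: tent2_def)
  have \<phi>0: "0 \<le> tent2 L x" for x by (simp add: tent2_def)
  have Wc: "continuous_on (strip R) W" unfolding W_def by (intro continuous_intros V N)
  have Gc: "continuous_on UNIV (\<lambda>x. G (x, t))" if "\<bar>t\<bar> \<le> R" for t
    unfolding G_def by (intro continuous_intros continuous_on_pot_sum_slice[OF b V N that])
  have GB: "0 \<le> G p" "G p \<le> B" if "p \<in> strip R" for p
    using pot_sum_bounded[where V = V and N = N and p = p, OF b bV[OF that] bN[OF that]] by (auto simp: G_def B_def)
  have B0: "0 \<le> B" using GB(1)[OF inS[of 0 0]] GB(2)[OF inS[of 0 0]] R by simp
  have K: "K > 0" using B0 L by (simp add: K_def add_nonneg_pos)
  have intW: "integrable lborel (\<lambda>x. tent2 L x * W (x, t))" if "\<bar>t\<bar> \<le> R" for t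
    by (rule integrable_weight[OF \<phi> continuous_on_slice[OF Wc that]])
  have J0: "0 \<le> J" unfolding J_def using \<phi>0 by (intro integral_nonneg_AE) auto
  have intJ: "integrable lborel (tent2 L)"
    using integrable_weight[OF \<phi>, where g = "\<lambda>_. 1"] by simp
  have "0 \<le> K * (R\<^sup>2 - y\<^sup>2) - I y"
  proof (rule sdiff_nonneg_imp_nonneg[where lo = "-R" and hi = R and f = "\<lambda>y. K * (R\<^sup>2 - y\<^sup>2) - I y"])
    have "continuous_on {-R..R} I" unfolding I_def
    proof (rule continuous_on_weight_integral[OF \<phi> Wc])
      show "\<bar>W p\<bar> \<le> 2 * M" if "p \<in> strip R" for p
        using bV[OF that] bN[OF that] by (auto simp: W_def)
    qed
    then show "continuous_on {-R..R} (\<lambda>y. K * (R\<^sup>2 - y\<^sup>2) - I y)" by (intro continuous_intros)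
    have "W (x, R) = 0" "W (x, -R) = 0" for x using bd[of x] by (simp_all add: W_def max_def)
    then have "I R = 0" "I (-R) = 0" by (simp_all add: I_def)
    then show "0 \<le> K * (R\<^sup>2 - R\<^sup>2) - I R" "0 \<le> K * (R\<^sup>2 - (-R)\<^sup>2) - I (-R)" by simp_all
    show "y \<in> {-R..R}" using y by auto
  next
    fix t assume t: "-R < t" "t < R"
    then have tR: "\<bar>t\<bar> < R" by auto
    define e where "e = 1 / (J + 1)"
    have e: "e > 0" "e * J < 1" using J0 by (auto simp: e_def)
    obtain k0 where k0: "0 < k0" "k0 \<le> 1" "k0 \<le> R - \<bar>t\<bar>"
      "\<And>k x. \<lbrakk>0 < k; k < k0; \<bar>x\<bar> \<le> L\<rbrakk> \<Longrightarrow>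
        sdiff (\<lambda>t. V (x, t) + N (x, t)) k t + sdiff (\<lambda>s. pot_sum b V N (s, t)) k x / 2 \<le> e * k\<^sup>2"
      by (rule supersol_sum[OF sV sN tR e(1), where X = L]) blast
    define k where "k = k0 / 2"
    have k: "0 < k" "k < k0" "k < 1" "\<bar>t + k\<bar> \<le> R" "\<bar>t - k\<bar> \<le> R" using k0(1-3) by (auto simp: k_def)
    \<comment> \<open>Where V + N < 0, the supersolution inequality changes sign and
      \<open>W\<close>, \<open>G\<close> dominate at the neighbouring points. Elsewhere
      \<open>W\<close> and \<open>G\<close> vanish at the centre, so their second differences are
      nonnegative.\<close>
    have pt: "- e * k\<^sup>2 - sdiff (\<lambda>s. G (s, t)) k x / 2 \<le> sdiff (\<lambda>t. W (x, t)) k t" if "\<bar>x\<bar> \<le> L" for x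
    proof (cases "V (x, t) + N (x, t) < 0")
      case True
      then have eq: "W (x, t) = - (V (x, t) + N (x, t))" "G (x, t) = - pot_sum b V N (x, t)"
        using pot_sum_nonpos[of V "(x, t)" N b] by (auto simp: W_def G_def)
      have ge: "- (V p + N p) \<le> W p" "- pot_sum b V N p \<le> G p" for p by (auto simp: W_def G_def)
      show ?thesis
        using k0(4)[OF k(1,2) that] ge(1)[of "(x, t + k)"] ge(1)[of "(x, t - k)"]
          ge(2)[of "(x + k, t)"] ge(2)[of "(x - k, t)"] eq
        unfolding sdiff_def by (simp add: field_simps)
    next
      case False
      then have "W (x, t) = 0" "G (x, t) = 0"
        using pot_sum_nonneg[of V "(x, t)" N b] by (auto simp: W_def G_def)
      moreover have "0 \<le> W p" "0 \<le> G p" for p by (auto simp: W_def G_def)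
      ultimately have "0 \<le> sdiff (\<lambda>t. W (x, t)) k t" "0 \<le> sdiff (\<lambda>s. G (s, t)) k x"
        by (auto simp: sdiff_def)
      moreover have "0 \<le> e * k\<^sup>2" using e by simp
      ultimately show ?thesis by linarith
    qed
    have intI: "sdiff I k t = (LINT x|lborel. tent2 L x * sdiff (\<lambda>t. W (x, t)) k t)"
    proof -
      have "(LINT x|lborel. tent2 L x * sdiff (\<lambda>t. W (x, t)) k t)
        = (LINT x|lborel. tent2 L x * W (x, t + k) + tent2 L x * W (x, t - k) - 2 * (tent2 L x * W (x, t)))"
        by (rule Bochner_Integration.integral_cong) (auto simp: sdiff_def algebra_simps)
      also have "\<dots> = sdiff I k t"
        using intW[OF k(4)] intW[OF k(5)] intW[of t] tR by (simp add: sdiff_def I_def)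
      finally show ?thesis by simp
    qed
    have cG: "continuous_on UNIV (\<lambda>x. sdiff (\<lambda>s. G (s, t)) k x)"
      unfolding sdiff_def using Gc[of t] tR
      by (intro continuous_intros continuous_on_compose2[OF Gc[of t]]) auto
    have intG: "integrable lborel (\<lambda>x. tent2 L x * sdiff (\<lambda>s. G (s, t)) k x)"
      by (rule integrable_weight[OF \<phi> cG])
    have sG: "(LINT x|lborel. tent2 L x * sdiff (\<lambda>s. G (s, t)) k x) \<le> 4 * k\<^sup>2 * B * (L + 1)"
    proof -
      have out: "sdiff (tent2 L) k x = 0" if "L + 1 < \<bar>x\<bar>" for x
        using that k \<phi>(2)[of x] \<phi>(2)[of "x + k"] \<phi>(2)[of "x - k"] by (simp add: sdiff_def)
      have cs: "continuous_on UNIV (\<lambda>x. sdiff (tent2 L) k x)"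
        unfolding sdiff_def by (intro continuous_intros continuous_on_compose2[OF \<phi>(1)]) auto
      have "(LINT x|lborel. tent2 L x * sdiff (\<lambda>s. G (s, t)) k x) = (LINT x|lborel. sdiff (tent2 L) k x * G (x, t))"
        using tR by (intro weight_sdiff_swap[OF \<phi>] Gc) auto
      also have "\<dots> \<le> (LINT x|lborel. (2 * k\<^sup>2 * B) * indicator {- (L + 1)..L + 1} x)"
      proof (rule integral_mono)
        show "integrable lborel (\<lambda>x. sdiff (tent2 L) k x * G (x, t))"
          using tR by (intro integrable_weight[OF cs out] Gc) auto
        show "integrable lborel (\<lambda>x. (2 * k\<^sup>2 * B) * indicator {- (L + 1)..L + 1} x)"
          by (rule integrable_const_on_Icc)
        fix x
        show "sdiff (tent2 L) k x * G (x, t) \<le> (2 * k\<^sup>2 * B) * indicator {- (L + 1)..L + 1} x"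
        proof (cases "x \<in> {- (L + 1)..L + 1}")
          case True
          have "sdiff (tent2 L) k x * G (x, t) \<le> (2 * k\<^sup>2) * G (x, t)"
            using GB[OF inS, of t x] tR k by (intro mult_right_mono sdiff_tent2_le) auto
          also have "\<dots> \<le> (2 * k\<^sup>2) * B"
            using GB[OF inS, of t x] tR by (intro mult_left_mono) auto
          finally show ?thesis using True by simp
        next
          case False
          then have "L + 1 < \<bar>x\<bar>" by auto
          then show ?thesis using out False by simp
        qed
      qed
      also have "\<dots> = 4 * k\<^sup>2 * B * (L + 1)" using L by simp
      finally show ?thesis .
    qed
    have "(LINT x|lborel. (- e * k\<^sup>2) * tent2 L x - (tent2 L x * sdiff (\<lambda>s. G (s, t)) k x) / 2) \<le> sdiff I k t"
      unfolding intI
    proof (rule integral_mono)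
      show "integrable lborel (\<lambda>x. (- e * k\<^sup>2) * tent2 L x - (tent2 L x * sdiff (\<lambda>s. G (s, t)) k x) / 2)"
        using intJ intG by simp
      have "integrable lborel (\<lambda>x. tent2 L x * W (x, t + k) + tent2 L x * W (x, t - k) - 2 * (tent2 L x * W (x, t)))"
        using intW[OF k(4)] intW[OF k(5)] intW[of t] tR by simp
      then show "integrable lborel (\<lambda>x. tent2 L x * sdiff (\<lambda>t. W (x, t)) k t)"
        by (simp add: sdiff_def algebra_simps)
      fix x
      show "(- e * k\<^sup>2) * tent2 L x - (tent2 L x * sdiff (\<lambda>s. G (s, t)) k x) / 2
          \<le> tent2 L x * sdiff (\<lambda>t. W (x, t)) k t"
      proof (cases "\<bar>x\<bar> \<le> L")
        case True
        from mult_left_mono[OF pt[OF True] \<phi>0[of x]] show ?thesis by (simp add: algebra_simps)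
      qed (use \<phi>(2)[of x] in simp)
    qed
    moreover have "(LINT x|lborel. (- e * k\<^sup>2) * tent2 L x - (tent2 L x * sdiff (\<lambda>s. G (s, t)) k x) / 2)
        = - (e * J) * k\<^sup>2 - (LINT x|lborel. tent2 L x * sdiff (\<lambda>s. G (s, t)) k x) / 2"
      using intJ intG by (simp add: J_def)
    ultimately have "- (e * J) * k\<^sup>2 - 2 * k\<^sup>2 * B * (L + 1) \<le> sdiff I k t"
      using sG by simp
    moreover have "(e * J) * k\<^sup>2 < 1 * k\<^sup>2" using e k by (intro mult_strict_right_mono) auto
    ultimately have "- K * k\<^sup>2 < sdiff I k t" by (simp add: K_def algebra_simps)
    moreover have "0 < K * k\<^sup>2" using K k by simp
    \<comment> \<open>The barrier K (R^2 - y^2) contributes -2 K k^2, twice what is needed against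
      the lower bound -K k^2 for the second difference of \<open>I\<close>.\<close>
    moreover have "sdiff (\<lambda>y. K * (R\<^sup>2 - y\<^sup>2) - I y) k t = - 2 * (K * k\<^sup>2) - sdiff I k t"
      by (simp add: sdiff_def power2_eq_square algebra_simps)
    ultimately have "sdiff (\<lambda>y. K * (R\<^sup>2 - y\<^sup>2) - I y) k t < 0" by simp
    then show "\<exists>k>0. - R \<le> t - k \<and> t + k \<le> R \<and> sdiff (\<lambda>y. K * (R\<^sup>2 - y\<^sup>2) - I y) k t < 0"
      using k by (intro exI[of _ k]) auto
  qed
  then have "I y \<le> K * (R\<^sup>2 - y\<^sup>2)" by simp
  also have "\<dots> \<le> K * R\<^sup>2" using K by (intro mult_left_mono) auto
  finally show ?thesis by (simp add: I_def W_def K_def B_def)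
qed

text \<open>If V + N were -m < 0 at a point, the weighted integral of the negative part would be at
  least L^2 m r / 4, while \<open>comparison_weighted\<close> bounds it by a multiple of L.\<close>

lemma comparison_principle:
  assumes b: "b \<noteq> 0" and V: "continuous_on (strip R) V" and N: "continuous_on (strip R) N"
    and bV: "\<And>p. p \<in> strip R \<Longrightarrow> \<bar>V p\<bar> \<le> M" and bN: "\<And>p. p \<in> strip R \<Longrightarrow> \<bar>N p\<bar> \<le> M"
    and sV: "supersol b R V" and sN: "supersol b R N"
    and bd: "\<And>x. 0 \<le> V (x, R) + N (x, R)" "\<And>x. 0 \<le> V (x, -R) + N (x, -R)"
    and p: "p \<in> strip R"
  shows "0 \<le> V p + N p"
proof (rule ccontr)
  obtain x1 y where xy: "p = (x1, y)" by force
  have y: "\<bar>y\<bar> \<le> R" using p by (simp add: xy strip_def)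
  assume neg: "\<not> 0 \<le> V p + N p"
  define W where "W x = max 0 (- (V (x, y) + N (x, y)))" for x
  have Wc: "continuous_on UNIV W"
    unfolding W_def by (intro continuous_intros continuous_on_slice[OF V y] continuous_on_slice[OF N y])
  define m where "m = W x1"
  have m: "m > 0" using neg by (simp add: m_def W_def xy)
  obtain d where d: "d > 0" "\<And>x. dist x x1 < d \<Longrightarrow> dist (W x) m < m / 2"
    using Wc m unfolding continuous_on_iff m_def by (metis UNIV_I half_gt_zero)
  define r where "r = min 1 (d / 2)"
  have r: "0 < r" "r \<le> 1" "r < d" using d by (auto simp: r_def)
  define B where "B = 4 * arsinh (M / \<bar>b\<bar>)"
  have B: "0 \<le> B"
    using potential_bounded[OF b bV[OF p]] unfolding B_def by (smt (verit) abs_ge_zero)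
  \<comment> \<open>The first entry makes \<open>tent2 L\<close> at least (L / 2)^2 on
    [x1 - r, x1 + r], as r <= 1; the second exceeds the upper bound for L derived at the
    end.\<close>
  define L where "L = max (2 * (\<bar>x1\<bar> + 1)) (4 * (2 * B + 1) * R\<^sup>2 / (m * r) + 1)"
  have L: "2 * (\<bar>x1\<bar> + 1) \<le> L" "4 * (2 * B + 1) * R\<^sup>2 / (m * r) < L" by (auto simp: L_def)
  have L1: "1 \<le> L" using L(1) abs_ge_zero[of x1] by argo
  have \<phi>: "continuous_on UNIV (tent2 L)" "\<And>x. L < \<bar>x\<bar> \<Longrightarrow> tent2 L x = 0"
    by (auto simp: continuous_on_tent2) (simp add: tent2_def)
  have "(LINT x|lborel. (L\<^sup>2 / 4 * (m / 2)) * indicator {x1 - r..x1 + r} x) \<le> (LINT x|lborel. tent2 L x * W x)"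
  proof (rule integral_mono)
    show "integrable lborel (\<lambda>x. (L\<^sup>2 / 4 * (m / 2)) * indicator {x1 - r..x1 + r} x)"
      by (rule integrable_const_on_Icc)
    show "integrable lborel (\<lambda>x. tent2 L x * W x)" by (rule integrable_weight[OF \<phi> Wc])
    fix x
    show "(L\<^sup>2 / 4 * (m / 2)) * indicator {x1 - r..x1 + r} x \<le> tent2 L x * W x"
    proof (cases "x \<in> {x1 - r..x1 + r}")
      case True
      then have "dist x x1 < d" using r by (auto simp: dist_real_def)
      from d(2)[OF this] have "m / 2 \<le> W x" unfolding dist_real_def by linarith
      moreover have "L / 2 \<le> max 0 (L - \<bar>x\<bar>)" using True r L by auto
      then have "(L / 2)\<^sup>2 \<le> tent2 L x" unfolding tent2_def
        by (rule power_mono) (use L1 in simp)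
      ultimately have "(L / 2)\<^sup>2 * (m / 2) \<le> tent2 L x * W x"
        using m by (intro mult_mono) (auto intro: order_trans[OF zero_le_power2])
      then show ?thesis using True by (simp add: power_divide)
    next
      case False
      then show ?thesis by (simp add: tent2_def W_def)
    qed
  qed
  also have "\<dots> \<le> (B * (L + 1) + 1) * R\<^sup>2"
    using comparison_weighted[OF b V N bV bN sV sN bd _ y, of L] L1 by (simp add: W_def B_def)
  also have "\<dots> \<le> ((2 * B + 1) * L) * R\<^sup>2"
  proof (rule mult_right_mono)
    have "B * 1 \<le> B * L" using B L1 by (intro mult_left_mono) auto
    then show "B * (L + 1) + 1 \<le> (2 * B + 1) * L" using L1 by (simp add: algebra_simps)
  qed simp
  finally have "L * (L * (m * r)) \<le> L * (4 * ((2 * B + 1) * R\<^sup>2))"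
    using r by (simp add: power2_eq_square algebra_simps)
  then have "L * (m * r) \<le> 4 * ((2 * B + 1) * R\<^sup>2)" using L1 by simp
  then have "L \<le> 4 * (2 * B + 1) * R\<^sup>2 / (m * r)" using m r by (simp add: field_simps)
  then show False using L(2) by simp
qed

section \<open>The cosine bump\<close>

text \<open>The first Dirichlet eigenfunction of the interval of radius \<open>s\<close> about
  \<open>x0\<close>, extended by 0: the \<open>min\<close> stops the argument at pi / 2, where the
  cosine vanishes.\<close>

definition bump :: "real \<Rightarrow> real \<Rightarrow> real \<Rightarrow> real" where
  "bump x0 s x = cos (pi / (2 * s) * min \<bar>x - x0\<bar> s)"

lemma continuous_on_bump: "continuous_on A (bump x0 s)"
  unfolding bump_def by (intro continuous_intros)

context
  fixes x0 s :: real
  assumes s: "0 < s"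
begin

lemma bump_nonneg: "0 \<le> bump x0 s x"
proof -
  have "pi / (2 * s) * min \<bar>x - x0\<bar> s \<le> pi / (2 * s) * s" using s by (intro mult_left_mono) auto
  moreover have "0 \<le> pi / (2 * s) * min \<bar>x - x0\<bar> s" using s by (intro mult_nonneg_nonneg) auto
  ultimately show ?thesis unfolding bump_def using s pi_gt_zero
    by (intro cos_ge_zero) (linarith, simp)
qed

lemma bump_outside: "s \<le> \<bar>x - x0\<bar> \<Longrightarrow> bump x0 s x = 0"
  using s by (simp add: bump_def min_absorb2)

lemma bump_inside: "\<bar>x - x0\<bar> \<le> s \<Longrightarrow> bump x0 s x = cos (pi / (2 * s) * (x - x0))"
  using s cos_abs_real[of "pi / (2 * s) * (x - x0)"] by (simp add: bump_def min_absorb1 abs_mult)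

text \<open>At distances between \<open>s\<close> and \<open>2 * s\<close> the cosine is
  nonpositive, so cutting it off at 0 only raises it.\<close>

lemma bump_ge_cos:
  assumes "\<bar>x - x0\<bar> \<le> 2 * s"
  shows "cos (pi / (2 * s) * (x - x0)) \<le> bump x0 s x"
proof (cases "\<bar>x - x0\<bar> \<le> s")
  case False
  have "cos (pi / (2 * s) * (x - x0)) = cos (pi / (2 * s) * \<bar>x - x0\<bar>)"
    using s by (subst cos_abs_real[symmetric]) (simp add: abs_mult)
  also have "\<dots> = - cos (pi - pi / (2 * s) * \<bar>x - x0\<bar>)" by simp
  also have "\<dots> \<le> 0"
  proof -
    have "pi / (2 * s) * s \<le> pi / (2 * s) * \<bar>x - x0\<bar>" "pi / (2 * s) * \<bar>x - x0\<bar> \<le> pi / (2 * s) * (2 * s)"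
      using s False assms by (auto intro!: mult_left_mono simp del: times_divide_eq_left)
    then have "0 \<le> cos (pi - pi / (2 * s) * \<bar>x - x0\<bar>)"
      using s by (intro cos_ge_zero) auto
    then show ?thesis by simp
  qed
  finally show ?thesis using bump_nonneg[of x] by linarith
qed (simp add: bump_inside)

text \<open>The discrete form of \<psi>'' >= -\<mu>^2 \<psi> with \<mu> = pi / (2 s). On the support
  the addition formula gives the second difference of the cosine exactly, the cut-off only raises
  the neighbouring values, and 1 - t^2 / 2 <= cos t.\<close>

lemma sdiff_bump_ge:
  assumes "0 \<le> k" "k \<le> s"
  shows "- ((pi / (2 * s))\<^sup>2 * k\<^sup>2 * bump x0 s x) \<le> sdiff (bump x0 s) k x"
proof (cases "\<bar>x - x0\<bar> \<le> s")
  case True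
  let ?m = "pi / (2 * s)"
  have c: "1 - (?m * k)\<^sup>2 / 2 \<le> cos (?m * k)" 
  proof -
    have "(sin (?m * k / 2))\<^sup>2 \<le> (?m * k / 2)\<^sup>2"
      using abs_sin_x_le_abs_x abs_le_square_iff by blast
    then show ?thesis using cos_double_sin[of "?m * k / 2"] by (simp add: power_divide)
  qed
  have "2 * (cos (m * (x - x0)) * cos (m * k)) = cos (m * (x + k - x0)) + cos (m * (x - k - x0))" for m
    using cos_times_cos[of "m * (x - x0)" "m * k"] by (simp add: algebra_simps)
  from this[of ?m]
  have "2 * bump x0 s x * cos (?m * k) = cos (?m * (x + k - x0)) + cos (?m * (x - k - x0))"
    by (simp only: bump_inside[OF True] mult.assoc)
  also have "\<dots> \<le> bump x0 s (x + k) + bump x0 s (x - k)"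
    using True assms by (intro add_mono bump_ge_cos) auto
  finally have "2 * bump x0 s x * (1 - (?m * k)\<^sup>2 / 2) \<le> bump x0 s (x + k) + bump x0 s (x - k)"
    using mult_left_mono[OF c, of "2 * bump x0 s x"] bump_nonneg[of x] by linarith
  then show ?thesis unfolding power_mult_distrib by (simp add: sdiff_def algebra_simps)
next
  case False
  then show ?thesis using bump_nonneg[of "x + k"] bump_nonneg[of "x - k"] bump_outside[of x]
    by (simp add: sdiff_def)
qed

lemma bump_integral_pos: "0 < (LINT x|lborel. bump x0 s x)"
proof -
  have bnd: "\<bar>x0\<bar> + s < \<bar>x\<bar> \<Longrightarrow> bump x0 s x = 0" for x by (rule bump_outside) linarith
  \<comment> \<open>Within two thirds of the radius the argument is at most pi / 3, where the cosine
    is at least 1 / 2.\<close>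
  have "(LINT x|lborel. (1 / 2) * indicator {x0 - 2 * s / 3..x0 + 2 * s / 3} x) \<le> (LINT x|lborel. bump x0 s x)"
  proof (rule integral_mono)
    show "integrable lborel (\<lambda>x. (1 / 2) * indicator {x0 - 2 * s / 3..x0 + 2 * s / 3} x :: real)"
      by (rule integrable_const_on_Icc)
    show "integrable lborel (bump x0 s)"
      using integrable_weight[OF continuous_on_bump bnd, where g = "\<lambda>_. 1"] by simp
    fix x
    show "(1 / 2) * indicator {x0 - 2 * s / 3..x0 + 2 * s / 3} x \<le> bump x0 s x"
    proof (cases "x \<in> {x0 - 2 * s / 3..x0 + 2 * s / 3}")
      case True
      then have x: "\<bar>x - x0\<bar> \<le> 2 * s / 3" unfolding abs_le_iff atLeastAtMost_iff by argo
      have "pi / (2 * s) * \<bar>x - x0\<bar> \<le> pi / (2 * s) * (2 * s / 3)" using s x by (intro mult_left_mono) auto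
      then have "cos (pi / 3) \<le> cos (pi / (2 * s) * \<bar>x - x0\<bar>)"
        using s by (intro cos_monotone_0_pi_le) auto
      then show ?thesis using True s x by (simp add: bump_def min_absorb1 cos_60)
    qed (use bump_nonneg in simp)
  qed
  moreover have "(LINT x|lborel. (1 / 2) * indicator {x0 - 2 * s / 3..x0 + 2 * s / 3} x) = 2 * s / 3"
    using s by simp
  ultimately show ?thesis using s by linarith
qed

end

section \<open>Barriers in y\<close>

text \<open>For f(y) = y exp(K y) the bound says f'' >= K f / y in discrete form. With K = \<mu>^2
  this is twice the coefficient K / (2 y) met in the inequality for E, and the surplus absorbs the
  error term.\<close>

lemma sdiff_mul_exp_ge:
  fixes K :: real
  assumes "0 \<le> y" "0 \<le> k" "0 \<le> K"
  shows "K * k\<^sup>2 * exp (K * y) \<le> sdiff (\<lambda>y. y * exp (K * y)) k y"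
proof -
  define A where "A = exp (K * k)"
  define A' where "A' = exp (- (K * k))"
  have "1 + K * k \<le> A" "1 - K * k \<le> A'" "A' \<le> 1"
    unfolding A_def A'_def using exp_ge_add_one_self[of "K * k"] exp_ge_add_one_self[of "- (K * k)"] assms by auto
  then have s2: "0 \<le> A + A' - 2" and s1: "K * k \<le> A - A'" by simp_all
  have "K * k\<^sup>2 \<le> y * (A + A' - 2) + k * (A - A')"
    using mult_nonneg_nonneg[OF assms(1) s2] mult_left_mono[OF s1 assms(2)]
    by (simp add: power2_eq_square algebra_simps)
  then have "exp (K * y) * (K * k\<^sup>2) \<le> exp (K * y) * (y * (A + A' - 2) + k * (A - A'))"
    by (intro mult_left_mono) auto
  also have "\<dots> = sdiff (\<lambda>y. y * exp (K * y)) k y"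
    by (simp add: sdiff_def A_def A'_def distrib_left right_diff_distrib exp_add exp_diff exp_minus divide_inverse)
       (simp add: algebra_simps)
  finally show ?thesis by (simp add: algebra_simps)
qed

text \<open>A barrier for right-hand sides of order |y|^(-1/2): the second derivative of y^(3/2) is
  (3 / 4) y^(-1/2). The constant drops to 1 / 2 because the mean value point is only known to be
  below 2 y.\<close>

lemma sdiff_abs_three_halves_ge:
  fixes y :: real
  assumes "0 < k" "k < \<bar>y\<bar>"
  shows "k\<^sup>2 / (2 * sqrt \<bar>y\<bar>) \<le> sdiff (\<lambda>y. \<bar>y\<bar> * sqrt \<bar>y\<bar>) k y"
proof -
  have pos: "k\<^sup>2 / (2 * sqrt y) \<le> sdiff (\<lambda>y. \<bar>y\<bar> * sqrt \<bar>y\<bar>) k y" if "k < y" for y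
  proof -
    have y: "0 < y" using that assms by simp
    have "\<exists>\<xi>. \<bar>\<xi> - y\<bar> < k \<and> sdiff (\<lambda>y. y * sqrt y) k y = k\<^sup>2 * (3 / (4 * sqrt \<xi>))"
    proof (rule sdiff_mvt[OF assms(1), where f' = "\<lambda>s. 3 / 2 * sqrt s"])
      fix t assume "\<bar>t - y\<bar> \<le> k"
      then have t: "0 < t" using that by linarith
      have "((\<lambda>y. y * sqrt y) has_real_derivative t * (inverse (sqrt t) / 2) + sqrt t) (at t)"
        using t by (auto intro!: derivative_eq_intros)
      moreover have "t * (inverse (sqrt t) / 2) + sqrt t = 3 / 2 * sqrt t"
        using t real_sqrt_mult_self[of t] by (simp add: field_simps)
      ultimately show "((\<lambda>y. y * sqrt y) has_real_derivative 3 / 2 * sqrt t) (at t)" by simp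
      show "((\<lambda>y. 3 / 2 * sqrt y) has_real_derivative 3 / (4 * sqrt t)) (at t)"
        using t by (auto intro!: derivative_eq_intros simp: field_simps)
    qed
    then obtain \<xi> where \<xi>: "\<bar>\<xi> - y\<bar> < k" "sdiff (\<lambda>y. y * sqrt y) k y = k\<^sup>2 * (3 / (4 * sqrt \<xi>))" by auto
    have x0: "0 < \<xi>" "\<xi> \<le> 2 * y" using \<xi>(1) that by auto
    \<comment> \<open>9 / 4 is a perfect square above 2.\<close>
    have "sqrt \<xi> \<le> sqrt ((9/4) * y)" using x0 y by (intro real_sqrt_le_mono) auto
    also have "\<dots> = 3 / 2 * sqrt y" by (simp add: real_sqrt_mult real_sqrt_divide)
    finally have "1 / (2 * sqrt y) \<le> 3 / (4 * sqrt \<xi>)" using x0 y by (simp add: field_simps)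
    then have "k\<^sup>2 * (1 / (2 * sqrt y)) \<le> k\<^sup>2 * (3 / (4 * sqrt \<xi>))" by (intro mult_left_mono) auto
    also have "\<dots> = sdiff (\<lambda>y. \<bar>y\<bar> * sqrt \<bar>y\<bar>) k y"
      unfolding \<xi>(2)[symmetric] sdiff_def using that assms y by simp
    finally show ?thesis by simp
  qed
  show ?thesis
  proof (cases "0 < y")
    case True
    then show ?thesis using pos[of y] assms by simp
  next
    case False
    have "sdiff (\<lambda>y. \<bar>y\<bar> * sqrt \<bar>y\<bar>) k (- y) = sdiff (\<lambda>y. \<bar>y\<bar> * sqrt \<bar>y\<bar>) k y"
      by (simp add: sdiff_def abs_minus_commute minus_diff_commute)
    then show ?thesis using pos[of "- y"] assms False by simp
  qed
qed

section \<open>Quantitative positivity of the bump average\<close>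

text \<open>A supersolution V and a subsolution -N, ordered on the strip and at least \<delta> apart
  on its boundary; the aim is bounds with constants free of b, V and N. The centre \<open>x0\<close>
  enters \<open>E\<close> and \<open>Gam\<close> but no assumption, so the predicate
  \<open>separated_supersols\<close> takes no such argument while an interpretation does.\<close>

locale separated_supersols =
  fixes b R M \<delta> x0 s :: real and V N :: "real \<times> real \<Rightarrow> real"
  assumes b: "b \<noteq> 0" and R: "0 < R" and \<delta>: "0 < \<delta>" and s: "0 < s"
    and V: "continuous_on (strip R) V" and N: "continuous_on (strip R) N"
    and bV: "\<And>p. p \<in> strip R \<Longrightarrow> \<bar>V p\<bar> \<le> M" and bN: "\<And>p. p \<in> strip R \<Longrightarrow> \<bar>N p\<bar> \<le> M"
    and sV: "supersol b R V" and sN: "supersol b R N"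
    and sum_nonneg: "\<And>p. p \<in> strip R \<Longrightarrow> 0 \<le> V p + N p"
    and sum_top: "\<And>x. \<delta> \<le> V (x, R) + N (x, R)" and sum_bot: "\<And>x. \<delta> \<le> V (x, -R) + N (x, -R)"
begin

abbreviation \<mu> :: real where "\<mu> \<equiv> pi / (2 * s)"
abbreviation J :: real where "J \<equiv> (LINT x|lborel. bump x0 s x)"

definition E :: "real \<Rightarrow> real" where
  "E y = (LINT x|lborel. bump x0 s x * (V (x, y) + N (x, y)))"

definition Gam :: "real \<Rightarrow> real" where
  "Gam y = (LINT x|lborel. bump x0 s x * pot_sum b V N (x, y))"

lemma mem_strip: "\<bar>y\<bar> \<le> R \<Longrightarrow> (x, y) \<in> strip R"
  by (simp add: strip_def)

lemma M_nonneg: "0 \<le> M"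
  using bV[OF mem_strip[of 0 0]] R by auto

lemma bump_supp: "\<bar>x0\<bar> + s < \<bar>x\<bar> \<Longrightarrow> bump x0 s x = 0"
  by (rule bump_outside[OF s]) linarith

lemma \<mu>_pos: "0 < \<mu>"
  using s by simp

lemmas J_pos = bump_integral_pos[OF s, of x0]

lemma integrable_bump: "continuous_on UNIV g \<Longrightarrow> integrable lborel (\<lambda>x. bump x0 s x * g x)"
  by (rule integrable_weight[OF continuous_on_bump bump_supp])

lemma integrable_bump': "integrable lborel (bump x0 s)"
  using integrable_bump[of "\<lambda>_. 1"] by simp

lemma sum_cont: "continuous_on (strip R) (\<lambda>p. V p + N p)"
  by (intro continuous_intros V N)

lemma integrable_sum: "\<bar>y\<bar> \<le> R \<Longrightarrow> integrable lborel (\<lambda>x. bump x0 s x * (V (x, y) + N (x, y)))"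
  by (rule integrable_bump[OF continuous_on_slice[OF sum_cont]])

lemma integrable_pot_sum: "\<bar>y\<bar> \<le> R \<Longrightarrow> integrable lborel (\<lambda>x. bump x0 s x * pot_sum b V N (x, y))"
  by (rule integrable_bump[OF continuous_on_pot_sum_slice[OF b V N]])

lemma E_nonneg: "\<bar>y\<bar> \<le> R \<Longrightarrow> 0 \<le> E y"
  unfolding E_def by (intro integral_nonneg_AE AE_I2 mult_nonneg_nonneg bump_nonneg[OF s] sum_nonneg mem_strip)

lemma E_top: "\<delta> * J \<le> E R"
proof -
  have "(LINT x|lborel. bump x0 s x * \<delta>) \<le> E R"
    unfolding E_def using R sum_top
    by (intro integral_mono integrable_sum mult_left_mono bump_nonneg[OF s] integrable_bump) auto
  then show ?thesis by (simp add: mult.commute)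
qed

lemma continuous_on_E: "continuous_on {-R..R} E"
  unfolding E_def
proof (rule continuous_on_weight_integral[OF continuous_on_bump bump_supp sum_cont])
  show "\<bar>V p + N p\<bar> \<le> 2 * M" if "p \<in> strip R" for p
    using bV[OF that] bN[OF that] by auto
qed

text \<open>The discrete form of E'' <= (\<mu>^2 / 2) Gam. The summed supersolution inequalities are
  integrated against the bump, the second difference in x moves to the bump, and
  \<open>sdiff_bump_ge\<close> is multiplied by \<open>pot_sum\<close>, whose sign comes from
  \<open>sum_nonneg\<close>.\<close>

lemma sdiff_E_le:
  assumes y: "\<bar>y\<bar> < R" and e: "0 < e"
  obtains k0 where "0 < k0" "k0 \<le> R - \<bar>y\<bar>"
    "\<And>k. \<lbrakk>0 < k; k < k0\<rbrakk> \<Longrightarrow> sdiff E k y \<le> k\<^sup>2 * (e * J + \<mu>\<^sup>2 / 2 * Gam y)"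
proof -
  obtain k1 where k1: "0 < k1" "k1 \<le> 1" "k1 \<le> R - \<bar>y\<bar>"
    "\<And>k x. \<lbrakk>0 < k; k < k1; \<bar>x\<bar> \<le> \<bar>x0\<bar> + s\<rbrakk> \<Longrightarrow>
      sdiff (\<lambda>t. V (x, t) + N (x, t)) k y + sdiff (\<lambda>s. pot_sum b V N (s, y)) k x / 2 \<le> e * k\<^sup>2"
    by (rule supersol_sum[OF sV sN y e, where X = "\<bar>x0\<bar> + s"]) blast
  let ?\<psi> = "bump x0 s"
  let ?G = "\<lambda>x. pot_sum b V N (x, y)"
  have Gc: "continuous_on UNIV ?G" using y by (intro continuous_on_pot_sum_slice[OF b V N]) auto
  show ?thesis
  proof (rule that[of "min k1 s"])
    show "0 < min k1 s" "min k1 s \<le> R - \<bar>y\<bar>" using k1 s by auto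
    fix k assume k: "0 < k" "k < min k1 s"
    have yk: "\<bar>y + k\<bar> \<le> R" "\<bar>y - k\<bar> \<le> R" "\<bar>y\<bar> \<le> R" using k k1(3) y by auto
    have cG: "continuous_on UNIV (\<lambda>x. sdiff ?G k x)"
      unfolding sdiff_def by (intro continuous_intros continuous_on_compose2[OF Gc]) auto
    have i3: "integrable lborel (\<lambda>x. ?\<psi> x * (V (x, y + k) + N (x, y + k)) + ?\<psi> x * (V (x, y - k) + N (x, y - k))
        - 2 * (?\<psi> x * (V (x, y) + N (x, y))))"
      using integrable_sum[OF yk(1)] integrable_sum[OF yk(2)] integrable_sum[OF yk(3)] by simp
    have eq: "?\<psi> x * sdiff (\<lambda>t. V (x, t) + N (x, t)) k y
        = ?\<psi> x * (V (x, y + k) + N (x, y + k)) + ?\<psi> x * (V (x, y - k) + N (x, y - k))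
        - 2 * (?\<psi> x * (V (x, y) + N (x, y)))" for x
      by (simp add: sdiff_def algebra_simps)
    have "sdiff E k y = (LINT x|lborel. ?\<psi> x * sdiff (\<lambda>t. V (x, t) + N (x, t)) k y)"
      unfolding eq using integrable_sum[OF yk(1)] integrable_sum[OF yk(2)] integrable_sum[OF yk(3)]
      by (simp add: sdiff_def E_def)
    also have "\<dots> \<le> (LINT x|lborel. (e * k\<^sup>2) * ?\<psi> x - (?\<psi> x * sdiff ?G k x) / 2)"
    proof (rule integral_mono)
      show "integrable lborel (\<lambda>x. ?\<psi> x * sdiff (\<lambda>t. V (x, t) + N (x, t)) k y)"
        unfolding eq by (rule i3)
      show "integrable lborel (\<lambda>x. (e * k\<^sup>2) * ?\<psi> x - (?\<psi> x * sdiff ?G k x) / 2)"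
        using integrable_bump' integrable_bump[OF cG] by simp
      fix x
      show "?\<psi> x * sdiff (\<lambda>t. V (x, t) + N (x, t)) k y \<le> (e * k\<^sup>2) * ?\<psi> x - (?\<psi> x * sdiff ?G k x) / 2"
      proof (cases "\<bar>x\<bar> \<le> \<bar>x0\<bar> + s")
        case True
        have "sdiff (\<lambda>t. V (x, t) + N (x, t)) k y \<le> e * k\<^sup>2 - sdiff ?G k x / 2"
          using k1(4)[of k x] k True by simp
        from mult_left_mono[OF this bump_nonneg[OF s, of x0 x]] show ?thesis by (simp add: algebra_simps)
      qed (use bump_supp[of x] in simp)
    qed
    also have "\<dots> = (e * k\<^sup>2) * J - (LINT x|lborel. ?\<psi> x * sdiff ?G k x) / 2"
      using integrable_bump' integrable_bump[OF cG] by simp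
    also have "(LINT x|lborel. ?\<psi> x * sdiff ?G k x) = (LINT x|lborel. sdiff ?\<psi> k x * ?G x)"
      by (rule weight_sdiff_swap[OF continuous_on_bump bump_supp Gc])
    finally have "sdiff E k y \<le> (e * k\<^sup>2) * J - (LINT x|lborel. sdiff ?\<psi> k x * ?G x) / 2" .
    moreover have "(LINT x|lborel. (- (\<mu>\<^sup>2 * k\<^sup>2)) * (?\<psi> x * ?G x)) \<le> (LINT x|lborel. sdiff ?\<psi> k x * ?G x)"
    proof (rule integral_mono)
      show "integrable lborel (\<lambda>x. (- (\<mu>\<^sup>2 * k\<^sup>2)) * (?\<psi> x * ?G x))"
        using integrable_pot_sum[OF yk(3)] by simp
      have "sdiff ?\<psi> k x = 0" if "\<bar>x0\<bar> + 2 * s < \<bar>x\<bar>" for x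
      proof -
        have "\<bar>x0\<bar> + s < \<bar>x\<bar>" "\<bar>x0\<bar> + s < \<bar>x + k\<bar>" "\<bar>x0\<bar> + s < \<bar>x - k\<bar>"
          using that k abs_triangle_ineq2[of x "- k"] abs_triangle_ineq2[of x k] s by auto
        then show ?thesis by (simp add: bump_supp sdiff_def)
      qed
      moreover have "continuous_on UNIV (\<lambda>x. sdiff ?\<psi> k x)"
        unfolding sdiff_def by (intro continuous_intros continuous_on_compose2[OF continuous_on_bump]) auto
      ultimately show "integrable lborel (\<lambda>x. sdiff ?\<psi> k x * ?G x)"
        using Gc by (intro integrable_weight) auto
      fix x
      have "- (\<mu>\<^sup>2 * k\<^sup>2 * ?\<psi> x) * ?G x \<le> sdiff ?\<psi> k x * ?G x"
        using k by (intro mult_right_mono sdiff_bump_ge[OF s] pot_sum_nonneg sum_nonneg mem_strip yk) auto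
      then show "(- (\<mu>\<^sup>2 * k\<^sup>2)) * (?\<psi> x * ?G x) \<le> sdiff ?\<psi> k x * ?G x" by (simp add: algebra_simps)
    qed
    ultimately have "sdiff E k y \<le> (e * k\<^sup>2) * J - (LINT x|lborel. (- (\<mu>\<^sup>2 * k\<^sup>2)) * (?\<psi> x * ?G x)) / 2"
      by linarith
    also have "(LINT x|lborel. (- (\<mu>\<^sup>2 * k\<^sup>2)) * (?\<psi> x * ?G x)) = (- (\<mu>\<^sup>2 * k\<^sup>2)) * Gam y"
      unfolding Gam_def by (rule integral_mult_right_zero)
    finally show "sdiff E k y \<le> k\<^sup>2 * (e * J + \<mu>\<^sup>2 / 2 * Gam y)"
      by (simp add: algebra_simps)
  qed
qed

lemma Gam_le_E:
  assumes "0 < y" "y \<le> R"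
  shows "Gam y \<le> E y / y"
proof -
  have y: "\<bar>y\<bar> \<le> R" using assms by simp
  have "Gam y \<le> (LINT x|lborel. (bump x0 s x * (V (x, y) + N (x, y))) / y)"
    unfolding Gam_def
  proof (rule integral_mono)
    fix x
    have "pot_sum b V N (x, y) \<le> (V (x, y) + N (x, y)) / y"
      using potential_diff_le[OF b assms(1), of "- N (x, y)" "V (x, y)"] sum_nonneg[OF mem_strip[OF y, of x]]
      by (simp add: pot_sum_def potential_minus)
    from mult_left_mono[OF this bump_nonneg[OF s]]
    show "bump x0 s x * pot_sum b V N (x, y) \<le> bump x0 s x * (V (x, y) + N (x, y)) / y" by simp
  qed (use integrable_sum[OF y] integrable_pot_sum[OF y] in auto)
  then show ?thesis by (simp add: E_def)
qed

lemma Gam_le_const: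
  assumes "\<bar>y\<bar> \<le> R" "\<And>x. pot_sum b V N (x, y) \<le> B"
  shows "Gam y \<le> J * B"
proof -
  have "Gam y \<le> (LINT x|lborel. bump x0 s x * B)"
    unfolding Gam_def using assms
    by (intro integral_mono integrable_pot_sum integrable_bump mult_left_mono bump_nonneg[OF s]) auto
  then show ?thesis by simp
qed

text \<open>Comparison with \<open>y exp (\<mu>\<^sup>2 y)\<close>: the coefficient of \<open>E\<close> in \<open>E'' \<le> (\<mu>\<^sup>2 / (2 y)) E\<close> is singular at
  \<open>y = 0\<close>, but the comparison function vanishes there.\<close>

lemma E_linear_growth:
  assumes y: "0 \<le> y" "y \<le> R"
  shows "\<delta> * J / (R * exp (\<mu>\<^sup>2 * R)) * y \<le> E y"
proof -
  \<comment> \<open>Normalised so that at y = R the comparison function equals \<delta> J, a lower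
    bound for \<open>E R\<close>.\<close>
  define c where "c = \<delta> * J / (R * exp (\<mu>\<^sup>2 * R))"
  define K where "K = \<mu>\<^sup>2"
  have c: "0 < c" unfolding c_def using \<delta> J_pos R by simp
  have K: "0 < K" using \<mu>_pos unfolding K_def by (rule zero_less_power)
  have "0 \<le> E y - c * (y * exp (K * y))"
  proof (rule sdiff_nonneg_imp_nonneg[where lo = 0 and hi = R and f = "\<lambda>y. E y - c * (y * exp (K * y))"])
    show "continuous_on {0..R} (\<lambda>y. E y - c * (y * exp (K * y)))"
      by (intro continuous_intros continuous_on_subset[OF continuous_on_E]) (use R in auto)
    show "0 \<le> E 0 - c * (0 * exp (K * 0))" using E_nonneg[of 0] R by simp
    have "c * (R * exp (K * R)) = \<delta> * J" using R by (simp add: c_def K_def)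
    then show "0 \<le> E R - c * (R * exp (K * R))" using E_top by simp
    show "y \<in> {0..R}" using y by simp
  next
    fix t assume t: "0 < t" "t < R" and neg: "E t - c * (t * exp (K * t)) < 0"
    \<comment> \<open>Then e J = K c / 4, while (K / 2) Gam t is at most (K c / 2) exp(K t);
      together they use at most three quarters of c K exp(K t).\<close>
    define e where "e = K * c / (4 * J)"
    have e: "0 < e" unfolding e_def using K c J_pos by simp
    have tR: "\<bar>t\<bar> < R" using t by simp
    obtain k0 where k0: "0 < k0" "k0 \<le> R - \<bar>t\<bar>"
      "\<And>k. \<lbrakk>0 < k; k < k0\<rbrakk> \<Longrightarrow> sdiff E k t \<le> k\<^sup>2 * (e * J + \<mu>\<^sup>2 / 2 * Gam t)"
      by (rule sdiff_E_le[OF tR e]) blast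
    define k where "k = min k0 t / 2"
    have k: "0 < k" "k < k0" "k < t" using k0(1) t by (auto simp: k_def)
    have "Gam t \<le> E t / t" using t by (intro Gam_le_E) auto
    also have "\<dots> \<le> c * exp (K * t)" using neg t by (simp add: field_simps)
    finally have "K / 2 * Gam t \<le> K / 2 * (c * exp (K * t))" using K by (intro mult_left_mono) auto
    moreover have "e * J = K * c / 4" using J_pos by (simp add: e_def)
    moreover have "K * c * 1 \<le> K * c * exp (K * t)" using K c t by (intro mult_left_mono) auto
    moreover have "0 < K * c" using K c by simp
    ultimately have "e * J + K / 2 * Gam t < c * K * exp (K * t)" by (simp add: algebra_simps)
    then have "k\<^sup>2 * (e * J + K / 2 * Gam t) < k\<^sup>2 * (c * K * exp (K * t))"
      using k by (intro mult_strict_left_mono) auto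
    then have "sdiff E k t < k\<^sup>2 * (c * K * exp (K * t))"
      using k0(3)[OF k(1,2)] unfolding K_def by linarith
    also have "\<dots> \<le> c * sdiff (\<lambda>y. y * exp (K * y)) k t"
      using mult_left_mono[OF sdiff_mul_exp_ge[of t k K], of c] t k K c by (simp add: algebra_simps)
    finally have "sdiff (\<lambda>y. E y - c * (y * exp (K * y))) k t < 0"
      by (simp add: sdiff_def algebra_simps)
    then show "\<exists>k>0. 0 \<le> t - k \<and> t + k \<le> R \<and> sdiff (\<lambda>y. E y - c * (y * exp (K * y))) k t < 0"
      using k k0(2) t by (intro exI[of _ k]) auto
  qed
  moreover have "c * (y * 1) \<le> c * (y * exp (K * y))"
    using c y K by (intro mult_left_mono) auto
  ultimately show ?thesis unfolding c_def[symmetric] by simp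
qed

text \<open>The growth of the potential is only logarithmic, so \<open>E\<close> minus a multiple of \<open>\<bar>y\<bar>\<^sup>3\<^sup>/\<^sup>2\<close> is concave
  uniformly in \<open>b\<close>; for small \<open>h\<close> the resulting error \<open>h\<^sup>3\<^sup>/\<^sup>2\<close> is beaten by the linear growth.\<close>

lemma E_zero_ge:
  assumes h: "0 < h" "h \<le> R" and ends: "m \<le> E h" "m \<le> E (- h)"
  shows "m - (4 * \<mu>\<^sup>2 * J * sqrt M + 1) * (h * sqrt h) \<le> E 0"
proof -
  \<comment> \<open>In units of |t|^(-1/2), half of C is 2 \<mu>^2 J sqrt M, which bounds (\<mu>^2 /
    2) Gam t, plus 1 / 2, which exceeds the 1 / 4 coming from e J.\<close>
  define C where "C = 4 * \<mu>\<^sup>2 * J * sqrt M + 1"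
  have C: "1 \<le> C" unfolding C_def using M_nonneg J_pos by simp
  define H where "H y = \<bar>y\<bar> * sqrt \<bar>y\<bar>" for y :: real
  have "0 \<le> E 0 - m + C * (H h - H 0)"
  proof (rule sdiff_nonneg_imp_nonneg[where lo = "-h" and hi = h and f = "\<lambda>y. E y - m + C * (H h - H y)"])
    show "continuous_on {-h..h} (\<lambda>y. E y - m + C * (H h - H y))"
      unfolding H_def by (intro continuous_intros continuous_on_subset[OF continuous_on_E]) (use h in auto)
    show "0 \<le> E h - m + C * (H h - H h)" "0 \<le> E (-h) - m + C * (H h - H (-h))"
      using ends by (auto simp: H_def)
    show "0 \<in> {-h..h}" using h by simp
  next
    fix t assume t: "- h < t" "t < h"
    have tR: "\<bar>t\<bar> < R" using t h by auto
    have "\<exists>k>0. k \<le> h - \<bar>t\<bar> \<and> sdiff E k t < C * sdiff H k t"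
    proof (cases "t = 0")
      case False
      define e where "e = 1 / (4 * J * sqrt \<bar>t\<bar>)"
      have e: "0 < e" unfolding e_def using J_pos False by simp
      obtain k0 where k0: "0 < k0" "k0 \<le> R - \<bar>t\<bar>"
        "\<And>k. \<lbrakk>0 < k; k < k0\<rbrakk> \<Longrightarrow> sdiff E k t \<le> k\<^sup>2 * (e * J + \<mu>\<^sup>2 / 2 * Gam t)"
        by (rule sdiff_E_le[OF tR e]) blast
      define k where "k = min (min k0 \<bar>t\<bar>) (h - \<bar>t\<bar>) / 2"
      have k: "0 < k" "k < k0" "k < \<bar>t\<bar>" "k \<le> h - \<bar>t\<bar>" using k0(1) t False by (auto simp: k_def)
      have "Gam t \<le> J * (4 * sqrt (M / \<bar>t\<bar>))"
      proof (rule Gam_le_const)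
        show "\<bar>t\<bar> \<le> R" using tR by simp
        fix x
        have "potential b t (V (x, t)) \<le> 2 * sqrt (M / \<bar>t\<bar>)" "potential b t (N (x, t)) \<le> 2 * sqrt (M / \<bar>t\<bar>)"
          using bV[OF mem_strip[of t x]] bN[OF mem_strip[of t x]] tR False M_nonneg
          by (auto intro!: potential_le)
        then show "pot_sum b V N (x, t) \<le> 4 * sqrt (M / \<bar>t\<bar>)" by (simp add: pot_sum_def)
      qed
      then have "\<mu>\<^sup>2 / 2 * Gam t \<le> \<mu>\<^sup>2 / 2 * (J * (4 * sqrt (M / \<bar>t\<bar>)))"
        by (intro mult_left_mono) auto
      also have "\<dots> = (2 * \<mu>\<^sup>2 * J * sqrt M) / sqrt \<bar>t\<bar>"
        by (simp add: real_sqrt_divide)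
      finally have "e * J + \<mu>\<^sup>2 / 2 * Gam t \<le> 1 / (4 * sqrt \<bar>t\<bar>) + (2 * \<mu>\<^sup>2 * J * sqrt M) / sqrt \<bar>t\<bar>"
        using J_pos by (simp add: e_def)
      also have "\<dots> < C / (2 * sqrt \<bar>t\<bar>)"
      proof -
        have "C / (2 * sqrt \<bar>t\<bar>) = (2 * \<mu>\<^sup>2 * J * sqrt M) / sqrt \<bar>t\<bar> + 1 / (2 * sqrt \<bar>t\<bar>)"
          by (simp add: C_def add_divide_distrib)
        moreover have "1 / (4 * sqrt \<bar>t\<bar>) < 1 / (2 * sqrt \<bar>t\<bar>)" using False by (simp add: field_simps)
        ultimately show ?thesis by linarith
      qed
      finally have "k\<^sup>2 * (e * J + \<mu>\<^sup>2 / 2 * Gam t) < k\<^sup>2 * (C / (2 * sqrt \<bar>t\<bar>))"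
        using k by (intro mult_strict_left_mono) auto
      also have "\<dots> = C * (k\<^sup>2 / (2 * sqrt \<bar>t\<bar>))" by simp
      also have "\<dots> \<le> C * sdiff H k t"
        using C k unfolding H_def[abs_def] by (intro mult_left_mono sdiff_abs_three_halves_ge) auto
      finally show ?thesis using k0(3)[OF k(1,2)] k by (intro exI[of _ k]) auto
    next
      case True
      obtain k0 where k0: "0 < k0" "k0 \<le> R - \<bar>t\<bar>"
        "\<And>k. \<lbrakk>0 < k; k < k0\<rbrakk> \<Longrightarrow> sdiff E k t \<le> k\<^sup>2 * (1 * J + \<mu>\<^sup>2 / 2 * Gam t)"
        by (rule sdiff_E_le[OF tR zero_less_one]) blast
      define D where "D = \<bar>1 * J + \<mu>\<^sup>2 / 2 * Gam t\<bar> + 1"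
      have D: "1 * J + \<mu>\<^sup>2 / 2 * Gam t < D" "1 \<le> D" by (auto simp: D_def)
      define k where "k = min (min k0 h / 2) (1 / D\<^sup>2)"
      have k: "0 < k" "k < k0" "k \<le> h" "k \<le> 1 / D\<^sup>2" using k0(1) h D by (auto simp: k_def)
      have "sqrt k \<le> 1 / D" using k(4) D by (intro real_le_lsqrt) (auto simp: power_divide)
      then have "D * sqrt k \<le> 1" using D by (simp add: field_simps)
      have "sdiff E k t \<le> k\<^sup>2 * (1 * J + \<mu>\<^sup>2 / 2 * Gam t)" by (rule k0(3)[OF k(1,2)])
      also have "\<dots> < k\<^sup>2 * D" using D k by (intro mult_strict_left_mono) auto
      also have "k\<^sup>2 * D = (k * sqrt k) * (D * sqrt k)"
        using k by (simp add: power2_eq_square)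
      also have "\<dots> \<le> (k * sqrt k) * 1" using k \<open>D * sqrt k \<le> 1\<close> by (intro mult_left_mono) auto
      also have "\<dots> \<le> (k * sqrt k) * (2 * C)" using k C by (intro mult_left_mono) auto
      also have "\<dots> = C * sdiff H k t" using True k by (simp add: sdiff_def H_def)
      finally show ?thesis using k True by (intro exI[of _ k]) auto
    qed
    then obtain k where k: "0 < k" "k \<le> h - \<bar>t\<bar>" "sdiff E k t < C * sdiff H k t" by blast
    then have "sdiff (\<lambda>y. E y - m + C * (H h - H y)) k t < 0"
      by (simp add: sdiff_def algebra_simps)
    then show "\<exists>k>0. - h \<le> t - k \<and> t + k \<le> h \<and> sdiff (\<lambda>y. E y - m + C * (H h - H y)) k t < 0"
      using k by (intro exI[of _ k]) auto
  qed
  then show ?thesis using h by (simp add: C_def H_def)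
qed

lemma reflected:
  "separated_supersols b R M \<delta> s (\<lambda>p. V (fst p, - snd p)) (\<lambda>p. N (fst p, - snd p))"
proof -
  have c: "continuous_on (strip R) (\<lambda>p. f (fst p, - snd p))" if "continuous_on (strip R) f" for f :: "real \<times> real \<Rightarrow> real"
    by (intro continuous_on_compose2[OF that] continuous_intros) (auto simp: strip_def)
  have m: "(fst p, - snd p) \<in> strip R" if "p \<in> strip R" for p using that by (simp add: strip_def)
  show ?thesis
    by unfold_locales
       (use b R \<delta> s V N sV sN sum_top sum_bot in
         \<open>auto intro!: c supersol_reflect bV bN sum_nonneg m\<close>)
qed

lemma E_linear_growth_abs:
  assumes "\<bar>y\<bar> \<le> R"
  shows "\<delta> * J / (R * exp (\<mu>\<^sup>2 * R)) * \<bar>y\<bar> \<le> E y"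
proof (cases "0 \<le> y")
  case True
  then show ?thesis using E_linear_growth[of y] assms by simp
next
  case False
  interpret r: separated_supersols b R M \<delta> x0 s "\<lambda>p. V (fst p, - snd p)" "\<lambda>p. N (fst p, - snd p)"
    by (rule reflected)
  show ?thesis using r.E_linear_growth[of "- y"] False assms by (simp add: r.E_def E_def)
qed

end

text \<open>For y nonzero the linear growth of E suffices. At y = 0 it is void, and
  \<open>E_zero_ge\<close> recovers a bound from the values at h and -h.\<close>

lemma separated_supersols_lower_bound:
  fixes x0 :: real
  assumes R: "0 < R" and \<delta>: "0 < \<delta>" and s: "0 < s" and M: "0 \<le> M" and y: "\<bar>y\<bar> \<le> R"
  obtains \<kappa> where "0 < \<kappa>"
    "\<And>b V N. separated_supersols b R M \<delta> s V N \<Longrightarrow>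
      \<kappa> \<le> (LINT x|lborel. bump x0 s x * (V (x, y) + N (x, y)))"
proof -
  define J where "J = (LINT x|lborel. bump x0 s x)"
  define \<mu> where "\<mu> = pi / (2 * s)"
  define c where "c = \<delta> * J / (R * exp (\<mu>\<^sup>2 * R))"
  have J: "0 < J" unfolding J_def by (rule bump_integral_pos[OF s])
  have c: "0 < c" unfolding c_def using R \<delta> J by simp
  show ?thesis
  proof (cases "y = 0")
    case False
    show ?thesis
    proof (rule that)
      show "0 < c * \<bar>y\<bar>" using c False by simp
      fix b V N assume "separated_supersols b R M \<delta> s V N"
      then interpret separated_supersols b R M \<delta> x0 s V N .
      show "c * \<bar>y\<bar> \<le> (LINT x|lborel. bump x0 s x * (V (x, y) + N (x, y)))"
        using E_linear_growth_abs[OF y] by (simp add: E_def c_def J_def \<mu>_def)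
    qed
  next
    case True
    define C where "C = 4 * \<mu>\<^sup>2 * J * sqrt M + 1"
    have C: "1 \<le> C" unfolding C_def using M J by simp
    \<comment> \<open>This makes the loss C h^(3/2) at most half of the gain c h.\<close>
    define h where "h = min R ((c / (2 * C))\<^sup>2)"
    have h: "0 < h" "h \<le> R" "h \<le> (c / (2 * C))\<^sup>2" using R c C by (auto simp: h_def)
    have "sqrt h \<le> c / (2 * C)" using h c C by (intro real_le_lsqrt) auto
    then have "C * sqrt h \<le> c / 2" using C by (simp add: field_simps)
    then have "h * (C * sqrt h) \<le> h * (c / 2)" using h by (intro mult_left_mono) auto
    then have le: "c * h / 2 \<le> c * h - C * (h * sqrt h)" by (simp add: algebra_simps)
    show ?thesis
    proof (rule that)
      show "0 < c * h / 2" using c h by simp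
      fix b V N assume "separated_supersols b R M \<delta> s V N"
      then interpret separated_supersols b R M \<delta> x0 s V N .
      have "c * h \<le> E h" "c * h \<le> E (- h)"
        using E_linear_growth_abs[of h] E_linear_growth_abs[of "- h"] h by (simp_all add: c_def J_def \<mu>_def)
      from E_zero_ge[OF h(1,2) this] le
      have "c * h / 2 \<le> E 0" unfolding C_def J_def \<mu>_def by linarith
      then show "c * h / 2 \<le> (LINT x|lborel. bump x0 s x * (V (x, y) + N (x, y)))"
        using True by (simp add: E_def)
    qed
  qed
qed

section \<open>Approximation, periodicity and boundary data\<close>

lemma Ck_add: "Ck (k + m) S B f \<Longrightarrow> Ck m S B f"
proof (induction k arbitrary: f)
  case (Suc k)
  have "Ck n S B f" if "Ck (Suc n) S B f" for n f
    using that by (induction n arbitrary: f) auto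
  with Suc show ?case by simp
qed simp

lemma Ck_imp_continuous_on: "Ck k S B f \<Longrightarrow> continuous_on S f"
  by (cases k) auto

lemma assoc_sol_continuous_on:
  assumes "assoc_sol k \<alpha> a R P phip phim u v"
  shows "continuous_on (strip R) v"
  using assms Ck_imp_continuous_on[of "k + 2" "strip R" "{ex, ey}" v]
  by (auto simp: assoc_sol_def sing_sol_def hoelder_def Let_def split: if_splits)

definition two_sided_supersol :: "real \<Rightarrow> real \<Rightarrow> (real \<times> real \<Rightarrow> real) \<Rightarrow> bool" where
  "two_sided_supersol b R w \<longleftrightarrow> continuous_on (strip R) w \<and> supersol b R w \<and> supersol b R (\<lambda>p. - w p)"

lemma two_sided_supersolI:
  assumes "b \<noteq> 0" "Ck 2 (strip R) {ex, ey} u" "Ck 2 (strip R) {ex, ey} v" "solves b R u v (strip R)"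
  shows "two_sided_supersol b R v"
  using solves_imp_supersol[OF assms] Ck_imp_continuous_on[OF assms(3)] by (simp add: two_sided_supersol_def)

text \<open>For a nonzero the solutions themselves serve, with b = a; for a = 0 members of the two
  approximating families do. One b must serve both functions, since F depends on b and only
  solutions of the same equation are compared.\<close>

lemma assoc_sol_approximants:
  assumes "assoc_sol k \<alpha> a R P phi1p phi1m u1 v1" "assoc_sol k \<alpha> a R P phi2p phi2m u2 v2" "0 < \<eta>"
  obtains b w1 w2 where "b \<noteq> 0" "two_sided_supersol b R w1" "two_sided_supersol b R w2"
    "\<And>p. p \<in> strip R \<Longrightarrow> \<bar>w1 p - v1 p\<bar> \<le> \<eta>" "\<And>p. p \<in> strip R \<Longrightarrow> \<bar>w2 p - v2 p\<bar> \<le> \<eta>"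
proof (cases "a = 0")
  case False
  have "two_sided_supersol a R v" if "assoc_sol k \<alpha> a R P pp pm u v" for u v pp pm
  proof -
    have h: "hoelder (k + 2) \<alpha> (strip R) {ex, ey} u" "hoelder (k + 2) \<alpha> (strip R) {ex, ey} v"
        "solves a R u v (strip R)"
      using that False unfolding assoc_sol_def by auto
    show ?thesis
      by (rule two_sided_supersolI[OF False Ck_add Ck_add h(3)]) (use h in \<open>unfold hoelder_def, blast+\<close>)
  qed
  then show ?thesis using assms False by (intro that[of a v1 v2]) auto
next
  case True
  have ap: "\<exists>vb. \<forall>\<^sub>F b in at_right 0. two_sided_supersol b R (vb b) \<and> (\<forall>p\<in>strip R. \<bar>vb b p - v p\<bar> \<le> \<eta>)"
    if sol: "assoc_sol k \<alpha> a R P pp pm u v" for u v pp pm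
  proof -
    obtain ub vb :: "real \<Rightarrow> real \<times> real \<Rightarrow> real" where
      lim: "uniform_limit (strip R) vb v (at_right 0)" and
      ev: "\<forall>\<^sub>F b in at_right 0. Ck 2 (strip R) {ex, ey} (ub b) \<and> Ck 2 (strip R) {ex, ey} (vb b) \<and>
             solves b R (ub b) (vb b) (strip R)"
      using sol True unfolding assoc_sol_def sing_sol_def Let_def by auto
    have "\<forall>\<^sub>F b in at_right 0. \<forall>p\<in>strip R. dist (vb b p) (v p) < \<eta>"
      using uniform_limitD[OF lim assms(3)] .
    moreover have "\<forall>\<^sub>F b in at_right (0::real). b \<noteq> 0"
      by (simp add: eventually_at_filter)
    ultimately have "\<forall>\<^sub>F b in at_right 0. two_sided_supersol b R (vb b) \<and> (\<forall>p\<in>strip R. \<bar>vb b p - v p\<bar> \<le> \<eta>)"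
      using ev by eventually_elim (auto intro!: two_sided_supersolI simp: dist_real_def less_imp_le)
    then show ?thesis by blast
  qed
  obtain f1 f2 where f:
    "\<forall>\<^sub>F b in at_right 0. two_sided_supersol b R (f1 b) \<and> (\<forall>p\<in>strip R. \<bar>f1 b p - v1 p\<bar> \<le> \<eta>)"
    "\<forall>\<^sub>F b in at_right 0. two_sided_supersol b R (f2 b) \<and> (\<forall>p\<in>strip R. \<bar>f2 b p - v2 p\<bar> \<le> \<eta>)"
    using ap[OF assms(1)] ap[OF assms(2)] by blast
  have "\<forall>\<^sub>F b in at_right (0::real). b \<noteq> 0" by (simp add: eventually_at_filter)
  with f have "\<forall>\<^sub>F b in at_right 0. b \<noteq> 0 \<and> (two_sided_supersol b R (f1 b) \<and> (\<forall>p\<in>strip R. \<bar>f1 b p - v1 p\<bar> \<le> \<eta>))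
      \<and> (two_sided_supersol b R (f2 b) \<and> (\<forall>p\<in>strip R. \<bar>f2 b p - v2 p\<bar> \<le> \<eta>))"
    by eventually_elim auto
  from eventually_happens'[OF _ this] obtain b where "b \<noteq> 0 \<and> (two_sided_supersol b R (f1 b) \<and> (\<forall>p\<in>strip R. \<bar>f1 b p - v1 p\<bar> \<le> \<eta>))
      \<and> (two_sided_supersol b R (f2 b) \<and> (\<forall>p\<in>strip R. \<bar>f2 b p - v2 p\<bar> \<le> \<eta>))"
    by auto
  then show ?thesis by (intro that[of b "f1 b" "f2 b"]) auto
qed

lemma periodic_reduce:
  fixes f :: "real \<Rightarrow> real"
  assumes P: "0 < P" and per: "\<And>x. f (x + P) = f x"
  obtains z where "z \<in> {0..P}" "f x = f z"
proof -
  have nat: "f (x + real n * P) = f x" for n x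
  proof (induction n)
    case (Suc n)
    then show ?case using per[of "x + real n * P"] by (simp add: algebra_simps)
  qed simp
  define n where "n = \<lfloor>x / P\<rfloor>"
  define z where "z = x - of_int n * P"
  have "of_int n \<le> x / P" "x / P < of_int n + 1" unfolding n_def by linarith+
  then have z: "z \<in> {0..P}" using P by (simp add: z_def field_simps)
  have "f x = f z"
  proof (cases "0 \<le> n")
    case True
    then show ?thesis using nat[of z "nat n"] by (simp add: z_def)
  next
    case False
    then show ?thesis using nat[of x "nat (- n)"] by (simp add: z_def)
  qed
  with z show ?thesis by (rule that)
qed

lemma periodic_bounded_strip:
  fixes v :: "real \<times> real \<Rightarrow> real"
  assumes P: "0 < P" and v: "continuous_on (strip R) v"
    and per: "\<And>x y. \<bar>y\<bar> \<le> R \<Longrightarrow> v (x + P, y) = v (x, y)"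
  obtains B where "\<And>p. p \<in> strip R \<Longrightarrow> \<bar>v p\<bar> \<le> B"
proof -
  have comp: "compact (v ` cbox (0, -R) (P, R))"
    by (intro compact_continuous_image continuous_on_subset[OF v] compact_cbox) (auto simp: strip_def cbox_Pair_eq)
  obtain B where B: "\<And>q. q \<in> cbox (0, -R) (P, R) \<Longrightarrow> \<bar>v q\<bar> \<le> B"
    using compact_imp_bounded[OF comp] unfolding bounded_iff by auto
  have "\<bar>v (x, y)\<bar> \<le> B" if y: "\<bar>y\<bar> \<le> R" for x y
  proof -
    obtain z where "z \<in> {0..P}" "v (x, y) = v (z, y)"
      using periodic_reduce[OF P, of "\<lambda>x. v (x, y)" x] per[OF y] by metis
    then show ?thesis using B[of "(z, y)"] y by (auto simp: cbox_Pair_eq abs_le_iff)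
  qed
  then show ?thesis by (intro that[of B]) (auto simp: strip_def)
qed

lemma hoelder_imp_continuous: "hoelder k \<alpha> S B f \<Longrightarrow> continuous_on S f"
  unfolding hoelder_def using Ck_imp_continuous_on by blast

lemma hoelder_imp_uniformly_continuous:
  fixes f :: "real \<Rightarrow> real"
  assumes "hoelder k \<alpha> UNIV B f" "0 < \<alpha>" "0 < e"
  obtains d where "0 < d" "\<And>x z. \<bar>x - z\<bar> \<le> d \<Longrightarrow> \<bar>f x - f z\<bar> \<le> e"
proof -
  \<comment> \<open>The empty list of directions gives the Hoelder bound of \<open>f\<close>
    itself.\<close>
  obtain C where C: "\<And>x z. \<bar>f x - f z\<bar> \<le> C * dist x z powr \<alpha>"
    using assms(1)[unfolded hoelder_def, THEN conjunct2, rule_format, of "[]"] by auto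
  \<comment> \<open>\<open>C\<close> may be zero or negative, so |C| + 1 is the divisor.\<close>
  define d where "d = (e / (\<bar>C\<bar> + 1)) powr (1 / \<alpha>)"
  have q: "0 < e / (\<bar>C\<bar> + 1)" using assms by (simp add: add_nonneg_pos)
  have d: "d powr \<alpha> = e / (\<bar>C\<bar> + 1)" using q assms by (simp add: d_def powr_powr)
  show ?thesis
  proof (rule that[of d])
    show "0 < d" by (metis d_def less_irrefl powr_gt_zero q)
    fix x z :: real assume xz: "\<bar>x - z\<bar> \<le> d"
    have "\<bar>f x - f z\<bar> \<le> C * dist x z powr \<alpha>" by (rule C)
    also have "\<dots> \<le> (\<bar>C\<bar> + 1) * dist x z powr \<alpha>" by (intro mult_right_mono) auto
    also have "\<dots> \<le> (\<bar>C\<bar> + 1) * d powr \<alpha>"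
      using xz assms(2) by (intro mult_left_mono powr_mono2) (auto simp: dist_real_def)
    also have "\<dots> = e" unfolding d by simp
    finally show "\<bar>f x - f z\<bar> \<le> e" .
  qed
qed

lemma periodic_gap:
  fixes f g :: "real \<Rightarrow> real"
  assumes P: "0 < P" and c: "continuous_on UNIV f" "continuous_on UNIV g"
    and per: "\<And>x. f (x + P) = f x" "\<And>x. g (x + P) = g x" and lt: "\<And>x. f x < g x"
  obtains d where "0 < d" "\<And>x. d \<le> g x - f x"
proof -
  have "continuous_on {0..P} (\<lambda>x. g x - f x)"
    by (intro continuous_intros continuous_on_subset[OF c(1)] continuous_on_subset[OF c(2)]) auto
  then obtain z where z: "\<And>x. x \<in> {0..P} \<Longrightarrow> g z - f z \<le> g x - f x"
    using continuous_attains_inf[OF compact_Icc, of 0 P] P by fastforce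
  show ?thesis
  proof (rule that)
    show "0 < g z - f z" using lt[of z] by simp
    fix x
    obtain t where "t \<in> {0..P}" "g x - f x = g t - f t"
      using periodic_reduce[OF P, of "\<lambda>x. g x - f x" x] per by auto
    then show "g z - f z \<le> g x - f x" using z by simp
  qed
qed

theorem theorem7p4:
  fixes R P a \<alpha> :: real and k :: nat
    and phi1p phi1m phi2p phi2m :: "real \<Rightarrow> real"
    and u1 v1 u2 v2 :: "real \<times> real \<Rightarrow> real"
  assumes "R > 0" and "P > 0" and "0 < \<alpha>" and "\<alpha> < 1"
    and "hoelder (k + 2) \<alpha> UNIV {1} phi1p" and "hoelder (k + 2) \<alpha> UNIV {1} phi1m"
    and "hoelder (k + 2) \<alpha> UNIV {1} phi2p" and "hoelder (k + 2) \<alpha> UNIV {1} phi2m"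
    and "\<forall>x. phi1p (x + P) = phi1p x \<and> phi1m (x + P) = phi1m x"
    and "\<forall>x. phi2p (x + P) = phi2p x \<and> phi2m (x + P) = phi2m x"
    and "\<forall>x. phi1p x < phi2p x \<and> phi1m x < phi2m x"
    and "integral {0..P} phi1p = integral {0..P} phi1m"
    and "integral {0..P} phi2p = integral {0..P} phi2m"
    and "assoc_sol k \<alpha> a R P phi1p phi1m u1 v1"
    and "assoc_sol k \<alpha> a R P phi2p phi2m u2 v2"
  shows "\<forall>p\<in>strip R. v1 p < v2 p"
proof (intro ballI, rule ccontr)
  fix p assume p: "p \<in> strip R" and "\<not> v1 p < v2 p"
  then have not_lt: "v2 p \<le> v1 p" by simp
  note R = assms(1) and P = assms(2) and \<alpha> = assms(3) and h1p = assms(5) and h1m = assms(6)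
    and h2p = assms(7) and h2m = assms(8) and per1 = assms(9) and per2 = assms(10) and lt = assms(11)
    and sol1 = assms(14) and sol2 = assms(15)
  obtain x0 y0 where xy: "p = (x0, y0)" by force
  have y0: "\<bar>y0\<bar> \<le> R" using p by (simp add: xy strip_def)
  have bdry: "v1 (x, R) = phi1p x" "v1 (x, -R) = phi1m x" "v2 (x, R) = phi2p x" "v2 (x, -R) = phi2m x" for x
    using sol1 sol2 by (auto simp: assoc_sol_def)
  have top: "(x, R) \<in> strip R" "(x, -R) \<in> strip R" for x using R by (auto simp: strip_def)
  have per: "v1 (x + P, y) = v1 (x, y)" "v2 (x + P, y) = v2 (x, y)" if "\<bar>y\<bar> \<le> R" for x y
    using sol1 sol2 that by (auto simp: assoc_sol_def)
  obtain B1 where B1: "\<And>p. p \<in> strip R \<Longrightarrow> \<bar>v1 p\<bar> \<le> B1"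
    using periodic_bounded_strip[OF P assoc_sol_continuous_on[OF sol1] per(1)] by blast
  obtain B2 where B2: "\<And>p. p \<in> strip R \<Longrightarrow> \<bar>v2 p\<bar> \<le> B2"
    using periodic_bounded_strip[OF P assoc_sol_continuous_on[OF sol2] per(2)] by blast
  obtain dp where dp: "0 < dp" "\<And>x. dp \<le> phi2p x - phi1p x"
    using periodic_gap[OF P hoelder_imp_continuous[OF h1p] hoelder_imp_continuous[OF h2p]] per1 per2 lt by blast
  obtain dm where dm: "0 < dm" "\<And>x. dm \<le> phi2m x - phi1m x"
    using periodic_gap[OF P hoelder_imp_continuous[OF h1m] hoelder_imp_continuous[OF h2m]] per1 per2 lt by blast
  \<comment> \<open>Of the boundary gap 4 \<delta>, one \<delta> is spent on shifting the boundary
    data of v1 and two on the two approximation errors; one is left for the locale.\<close>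
  define \<delta> where "\<delta> = min dp dm / 4"
  have \<delta>: "0 < \<delta>" "\<And>x. 4 * \<delta> \<le> phi2p x - phi1p x" "\<And>x. 4 * \<delta> \<le> phi2m x - phi1m x"
    using dp(1) dm(1) order_trans[OF min.cobounded1 dp(2)] order_trans[OF min.cobounded2 dm(2)]
    by (auto simp: \<delta>_def)
  obtain ep where ep: "0 < ep" "\<And>x z. \<bar>x - z\<bar> \<le> ep \<Longrightarrow> \<bar>phi1p x - phi1p z\<bar> \<le> \<delta>"
    using hoelder_imp_uniformly_continuous[OF h1p \<alpha> \<delta>(1)] by blast
  obtain em where em: "0 < em" "\<And>x z. \<bar>x - z\<bar> \<le> em \<Longrightarrow> \<bar>phi1m x - phi1m z\<bar> \<le> \<delta>"
    using hoelder_imp_uniformly_continuous[OF h1m \<alpha> \<delta>(1)] by blast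
  \<comment> \<open>The minimising shifts for V and N each have size at most s, so they differ by up
    to 2 s.\<close>
  define s where "s = min ep em / 2"
  have s: "0 < s" "2 * s \<le> ep" "2 * s \<le> em" using ep em by (auto simp: s_def)
  define M where "M = max B1 B2 + \<delta>"
  have M: "0 \<le> M" using B1[OF p] \<delta>(1) by (auto simp: M_def)
  define J where "J = (LINT x|lborel. bump x0 s x)"
  have J: "0 < J" unfolding J_def by (rule bump_integral_pos[OF s(1)])
  obtain \<kappa> where \<kappa>: "0 < \<kappa>" "\<And>b V N. separated_supersols b R M \<delta> s V N \<Longrightarrow>
      \<kappa> \<le> (LINT x|lborel. bump x0 s x * (V (x, y0) + N (x, y0)))"
    using separated_supersols_lower_bound[OF R \<delta>(1) s(1) M y0] by blast
  \<comment> \<open>\<kappa> was fixed without reference to the approximation, so the accuracy may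
    be chosen after it; then 2 \<eta> J is at most \<kappa> / 2.\<close>
  define \<eta> where "\<eta> = min \<delta> (\<kappa> / (4 * J))"
  have \<eta>: "0 < \<eta>" "\<eta> \<le> \<delta>" "2 * \<eta> * J < \<kappa>"
  proof -
    show "0 < \<eta>" "\<eta> \<le> \<delta>" using \<delta>(1) \<kappa>(1) J by (auto simp: \<eta>_def)
    have "\<eta> * J \<le> \<kappa> / (4 * J) * J" unfolding \<eta>_def using J by (intro mult_right_mono) auto
    then show "2 * \<eta> * J < \<kappa>" using J \<kappa>(1) by simp
  qed
  obtain b w1 w2 where b: "b \<noteq> 0" and good: "two_sided_supersol b R w1" "two_sided_supersol b R w2"
    and close: "\<And>p. p \<in> strip R \<Longrightarrow> \<bar>w1 p - v1 p\<bar> \<le> \<eta>" "\<And>p. p \<in> strip R \<Longrightarrow> \<bar>w2 p - v2 p\<bar> \<le> \<eta>"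
    using assoc_sol_approximants[OF sol1 sol2 \<eta>(1)] by blast
  have c1: "continuous_on (strip R) (\<lambda>p. - w1 p)" and c2: "continuous_on (strip R) w2"
    and s1: "supersol b R (\<lambda>p. - w1 p)" and s2: "supersol b R w2"
    using good by (auto simp: two_sided_supersol_def intro!: continuous_intros)
  have s0: "0 \<le> s" using s by simp
  define V where "V = inf_translates s w2"
  define N where "N = inf_translates s (\<lambda>p. - w1 p)"
  have att: "\<exists>t t'. \<bar>t\<bar> \<le> s \<and> \<bar>t'\<bar> \<le> s \<and> V (x, y) = w2 (x + t, y) \<and> N (x, y) = - w1 (x + t', y)"
    if "\<bar>y\<bar> \<le> R" for x y
    using inf_translates_attained[OF c1 s0 that, of x] inf_translates_attained[OF c2 s0 that, of x]
    unfolding V_def N_def by metis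
  have bnd: "\<bar>V q\<bar> \<le> M" "\<bar>N q\<bar> \<le> M" if q: "q \<in> strip R" for q
  proof -
    obtain x y where q': "q = (x, y)" by force
    have y: "\<bar>y\<bar> \<le> R" using q by (simp add: q' strip_def)
    then have mem: "(z, y) \<in> strip R" for z by (simp add: strip_def)
    obtain t t' where "V q = w2 (x + t, y)" "N q = - w1 (x + t', y)" using att[OF y, of x] q' by auto
    moreover have "\<bar>w2 (x + t, y)\<bar> \<le> M" "\<bar>w1 (x + t', y)\<bar> \<le> M"
      using close(2)[OF mem, of "x + t"] B2[OF mem, of "x + t"] close(1)[OF mem, of "x + t'"] B1[OF mem, of "x + t'"] \<eta>(2)
      unfolding M_def by linarith+
    ultimately show "\<bar>V q\<bar> \<le> M" "\<bar>N q\<bar> \<le> M" by simp_all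
  qed
  have gap: "\<delta> \<le> V (x, R) + N (x, R)" "\<delta> \<le> V (x, -R) + N (x, -R)" for x
  proof -
    obtain t t' where t: "\<bar>t\<bar> \<le> s" "\<bar>t'\<bar> \<le> s" "V (x, R) = w2 (x + t, R)" "N (x, R) = - w1 (x + t', R)"
      using att[of R x] R by auto
    have "\<bar>phi1p (x + t) - phi1p (x + t')\<bar> \<le> \<delta>" using t s by (intro ep(2)) auto
    then show "\<delta> \<le> V (x, R) + N (x, R)"
      using \<delta>(2)[of "x + t"] close(1)[OF top(1), of "x + t'"] close(2)[OF top(1), of "x + t"] \<eta>(2) t(3,4)
      unfolding bdry by linarith
    obtain t t' where t: "\<bar>t\<bar> \<le> s" "\<bar>t'\<bar> \<le> s" "V (x, -R) = w2 (x + t, -R)" "N (x, -R) = - w1 (x + t', -R)"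
      using att[of "-R" x] R by auto
    have "\<bar>phi1m (x + t) - phi1m (x + t')\<bar> \<le> \<delta>" using t s by (intro em(2)) auto
    then show "\<delta> \<le> V (x, -R) + N (x, -R)"
      using \<delta>(3)[of "x + t"] close(1)[OF top(2), of "x + t'"] close(2)[OF top(2), of "x + t"] \<eta>(2) t(3,4)
      unfolding bdry by linarith
  qed
  have cV: "continuous_on (strip R) V" and cN: "continuous_on (strip R) N"
    unfolding V_def N_def using c1 c2 s0 by (auto intro!: continuous_on_inf_translates)
  have sV: "supersol b R V" and sN: "supersol b R N"
    unfolding V_def N_def using c1 c2 s1 s2 s0 by (auto intro!: supersol_inf_translates)
  have "0 \<le> V q + N q" if "q \<in> strip R" for q
    by (rule comparison_principle[OF b cV cN bnd(1) bnd(2) sV sN _ _ that])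
       (use gap \<delta>(1) less_imp_le order_trans in \<open>metis+\<close>)
  then interpret separated_supersols b R M \<delta> x0 s V N
    using b R \<delta>(1) s(1) cV cN bnd sV sN gap by unfold_locales auto
  have "(LINT x|lborel. bump x0 s x * (V (x, y0) + N (x, y0))) \<le> (LINT x|lborel. bump x0 s x * (2 * \<eta>))"
  proof (rule integral_mono[OF integrable_sum[OF y0] integrable_bump])
    fix x
    show "bump x0 s x * (V (x, y0) + N (x, y0)) \<le> bump x0 s x * (2 * \<eta>)"
    proof (cases "\<bar>x - x0\<bar> \<le> s")
      case True
      \<comment> \<open>The point x0 is x shifted by x0 - x, an admissible shift in both
        infima.\<close>
      then have "\<bar>x0 - x\<bar> \<le> s" by simp
      from inf_translates_le[OF c2 this y0, of x] inf_translates_le[OF c1 this y0, of x]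
      have "V (x, y0) + N (x, y0) \<le> w2 p - w1 p" by (simp add: V_def N_def xy)
      also have "\<dots> \<le> 2 * \<eta>" using close(1)[OF p] close(2)[OF p] not_lt by linarith
      finally show ?thesis by (intro mult_left_mono bump_nonneg[OF s(1)])
    next
      case False
      then show ?thesis using bump_outside[OF s(1), of x x0] by simp
    qed
  qed simp
  also have "\<dots> = 2 * \<eta> * J" by (simp add: J_def)
  also have "\<dots> < \<kappa>" by (rule \<eta>(3))
  finally show False using \<kappa>(2)[OF separated_supersols_axioms] by simp
qed

end
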